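(* Let $\{\boldsymbol s(k):k\in\mathbb Z_+\}$ be a given sequence of i.i.d. potential service vectors with mean $\boldsymbol\mu$ and $\mu_\Sigma=\sum_{i=1}^n\mu_i$, let $\epsilon\in(0,\mu_\Sigma)$, and consider the discrete-time load balancing system with $n$ servers operating under power-of-$d$ choices, parametrized by $\epsilon$ as described in the context (in particular the arrival process has mean $\lambda^{(\epsilon)}=\mu_\Sigma-\epsilon$). Suppose $2\le d\le n$, and that the number of arrivals and the potential service in each time slot are bounded. Let $\boldsymbol\mu\in\mathrm{Int}(\mathcal M^{(d)})$, where $\mathrm{Int}$ denotes interior in $\mathbb R^n$ and $$\mathcal M^{(d)}=\left\{\boldsymbol\mu\in\mathbb R_+^n:\ \frac{\sum_{i=1}^{j}\mu_{(i)}}{\mu_\Sigma}\ \ge\ \frac{\binom{j}{d}}{\binom{n}{d}}\quad\text{for all integers } j \text{ with } d\le j\le n-1\right\}.$$ Let $\overline{\boldsymbol q}^{(\epsilon)}$ be a steady-state random vector such that $\{\boldsymbol q^{(\epsilon)}(k):k\in\mathbb Z_+\}$ converges in distribution to $\overline{\boldsymbol q}^{(\epsilon)}$ as $k\to\infty$. Let $\delta>0$ be such that $$\frac{\sum_{i=1}^{j}\mu_{(i)}}{\mu_\Sigma}-\delta\ \ge\ \frac{\binom{j}{d}}{\binom{n}{d}}\qquad\text{for all integers } j\text{ with } d\le j\le n-1 .$$ If $\epsilon<\delta\mu_\Sigma$, then $$\mathbb E\left[\big\|\overline{\boldsymbol q}^{(\epsilon)}_\perp\big\|^m\right]\le M_m\qquad\text{for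 each } m=1,2,\dots,$$ where $M_m$ is a finite constant (independent of $\epsilon$).
   Context: Notation: $\mathbb R_+$, $\mathbb Z_+$ are the nonnegative reals and integers; $\mu_{(i)}$ is the $i$-th smallest entry of $\boldsymbol\mu$; $\|\cdot\|$ is the Euclidean norm; $\boldsymbol 1$ is the all-ones vector. For $\boldsymbol x\in\mathbb R^n$, $\boldsymbol x_\parallel=\boldsymbol 1\,\frac{\sum_{i=1}^n x_i}{n}$ and $\boldsymbol x_\perp=\boldsymbol x-\boldsymbol x_\parallel$. Model. Time is slotted, $k\in\mathbb Z_+$. There are $n$ servers, each with an infinite-buffer queue; $q_i(k)\in\mathbb Z_+$ is the number of jobs in queue $i$ (including any in service) at the beginning of slot $k$, and $\boldsymbol q(k)=(q_1(k),\dots,q_n(k))$. The total number of arrivals in slot $k$ is $a(k)\in\mathbb Z_+$, with $\{a(k)\}$ i.i.d. In each slot a dispatcher sends all arrivals of that slot to a single queue $i^*$, so $a_{i^*}(k)=a(k)$ and $a_i(k)=0$ for $i\ne i^*$. The potential service vectors $\boldsymbol s(k)\in\mathbb Z_+^n$ ($s_i(k)$ is the number of jobs that can be processed in queue $i$ in slot $k$ if there are enough jobs in line) are i.i.d. over $k$ (entries within a slot may be dependent), with mean $\boldsymbol\mu=\mathbb E[\boldsymbol s(1)]$, and are independent of the arrivals; $\boldsymbol s(k)$ is independent of the queue lengths up to slot $k$ and of the routing decision in slot $k$. Arrivals and routing occur before service in each slot, so $$q_i(k+1)=q_i(k)+a_i(k)-s_i(k)+u_i(k),\qquad u_i(k)=\max\{s_i(k)-q_i(k)-a_i(k),0\}.$$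 Power-of-$d$ choices. In each slot, select $d$ distinct queues uniformly at random among the $n$ queues and route all arrivals of the slot to a shortest (with respect to $\boldsymbol q(k)$) of the selected queues, ties being broken at random. Heavy-traffic parametrization. The sequence of service vectors $\{\boldsymbol s(k)\}$ is fixed (it does not depend on $\epsilon$). For each $\epsilon\in(0,\mu_\Sigma)$, the system parametrized by $\epsilon$ has an i.i.d. arrival sequence $\{a^{(\epsilon)}(k)\}$ with mean $\lambda^{(\epsilon)}=\mathbb E[a^{(\epsilon)}(1)]=\mu_\Sigma-\epsilon$; its queue length process is denoted $\{\boldsymbol q^{(\epsilon)}(k)\}$. *)

theory Defs
  imports "HOL-Probability.Probability"
begin

section \<open>Vectors indexed by the servers\<close>

text \<open>The servers are the elements of a finite type, so \<^term>\<open>CARD('n)\<close> is their number.\<close>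

definition entry_sum :: "real ^ 'n \<Rightarrow> real" where
  "entry_sum x = (\<Sum>i\<in>UNIV. x $ i)"

definition parallel :: "real ^ 'n \<Rightarrow> real ^ 'n" where
  "parallel x = (entry_sum x / real CARD('n)) *\<^sub>R 1"

definition perp :: "real ^ 'n \<Rightarrow> real ^ 'n" where
  "perp x = x - parallel x"

text \<open>The \<open>i\<close>-th smallest entry, counted with multiplicity, for \<open>1 \<le> i \<le> CARD('n)\<close>.\<close>

definition order_stat :: "real ^ 'n \<Rightarrow> nat \<Rightarrow> real" where
  "order_stat x i =
     sorted_list_of_multiset (image_mset (\<lambda>j. x $ j) (mset_set UNIV)) ! (i - 1)"

definition real_vec :: "nat ^ 'n \<Rightarrow> real ^ 'n" where
  "real_vec x = (\<chi> i. real (x $ i))"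

text \<open>At \<open>\<mu> = 0\<close> the quotient has the value \<open>0\<close>; this does not affect the interior of the
  region, which only contains vectors with positive entries.\<close>

definition capacity_region :: "nat \<Rightarrow> (real ^ 'n) set" where
  "capacity_region d = {\<mu>. (\<forall>i. 0 \<le> \<mu> $ i) \<and>
     (\<forall>j. d \<le> j \<and> j \<le> CARD('n) - 1 \<longrightarrow>
        (\<Sum>i=1..j. order_stat \<mu> i) / entry_sum \<mu>
          \<ge> real (j choose d) / real (CARD('n) choose d))}"


section \<open>Probabilistic notions\<close>

context prob_space
begin

text \<open>Unlike \<^const>\<open>indep_var\<close>, this allows the two random variables to have values of
  different types.\<close>

definition indep_rv ::
    "'b measure \<Rightarrow> ('a \<Rightarrow> 'b) \<Rightarrow> 'c measure \<Rightarrow> ('a \<Rightarrow> 'c) \<Rightarrow> bool" where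
  "indep_rv S X T Y \<longleftrightarrow> random_variable S X \<and> random_variable T Y \<and>
     indep_set {X -` A \<inter> space M | A. A \<in> sets S} {Y -` B \<inter> space M | B. B \<in> sets T}"

definition iid :: "'b measure \<Rightarrow> (nat \<Rightarrow> 'a \<Rightarrow> 'b) \<Rightarrow> bool" where
  "iid S X \<longleftrightarrow> indep_vars (\<lambda>_. S) X UNIV \<and> (\<forall>k. distr M S (X k) = distr M S (X 0))"

text \<open>Conditionally on \<open>X = x\<close>, the variable \<open>Y\<close> is uniformly distributed on the finite nonempty
  set \<open>A x\<close>. The formulation is meant for \<open>X\<close> and \<open>Y\<close> with countably many values.\<close>

definition uniform_given :: "('a \<Rightarrow> 'b) \<Rightarrow> ('b \<Rightarrow> 'c set) \<Rightarrow> ('a \<Rightarrow> 'c) \<Rightarrow> bool" where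
  "uniform_given X A Y \<longleftrightarrow> (\<forall>x y.
     prob {\<omega>\<in>space M. X \<omega> = x \<and> Y \<omega> = y} =
     prob {\<omega>\<in>space M. X \<omega> = x} * (if y \<in> A x then 1 / real (card (A x)) else 0))"

end

definition converges_in_distribution ::
    "'a measure \<Rightarrow> (nat \<Rightarrow> 'a \<Rightarrow> 'c::topological_space) \<Rightarrow> 'b measure \<Rightarrow> ('b \<Rightarrow> 'c) \<Rightarrow> bool" where
  "converges_in_distribution M X N Y \<longleftrightarrow>
     (\<forall>f :: 'c \<Rightarrow> real. continuous_on UNIV f \<and> bounded (range f) \<longrightarrow>
        (\<lambda>k. \<integral>\<omega>. f (X k \<omega>) \<partial>M) \<longlonglongrightarrow> (\<integral>\<omega>. f (Y \<omega>) \<partial>N))"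


section \<open>Load balancing under power-of-\<open>d\<close> choices\<close>

text \<open>In slot \<open>k\<close> there are \<open>a k\<close> arrivals and potential services \<open>s k\<close>; \<open>D k\<close> is the set of
  selected queues, \<open>r k\<close> the queue that receives all the arrivals, and \<open>q k\<close> the vector of queue
  lengths at the beginning of the slot. The distribution of \<open>q 0\<close> is arbitrary.\<close>

definition routed :: "(nat \<Rightarrow> 'w \<Rightarrow> nat) \<Rightarrow> (nat \<Rightarrow> 'w \<Rightarrow> 'n) \<Rightarrow> nat \<Rightarrow> 'w \<Rightarrow> 'n \<Rightarrow> nat" where
  "routed a r k \<omega> i = (if i = r k \<omega> then a k \<omega> else 0)"

definition unused :: "(nat \<Rightarrow> 'w \<Rightarrow> nat) \<Rightarrow> (nat \<Rightarrow> 'w \<Rightarrow> nat ^ 'n) \<Rightarrow> (nat \<Rightarrow> 'w \<Rightarrow> 'n) \<Rightarrow>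
    (nat \<Rightarrow> 'w \<Rightarrow> nat ^ 'n) \<Rightarrow> nat \<Rightarrow> 'w \<Rightarrow> 'n \<Rightarrow> int" where
  "unused a s r q k \<omega> i =
     max (int (s k \<omega> $ i) - int (q k \<omega> $ i) - int (routed a r k \<omega> i)) 0"

definition queue_history :: "(nat \<Rightarrow> 'w \<Rightarrow> nat ^ 'n) \<Rightarrow> nat \<Rightarrow> 'w \<Rightarrow> (nat ^ 'n) list" where
  "queue_history q k \<omega> = map (\<lambda>j. q j \<omega>) [0..<Suc k]"

definition shortest :: "nat ^ 'n \<Rightarrow> 'n set \<Rightarrow> 'n set" where
  "shortest x S = {i\<in>S. \<forall>j\<in>S. x $ i \<le> x $ j}"

locale power_of_d_system = prob_space M
  for M :: "'w measure" +
  fixes d :: nat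
    and a :: "nat \<Rightarrow> 'w \<Rightarrow> nat"
    and s :: "nat \<Rightarrow> 'w \<Rightarrow> nat ^ 'n"
    and D :: "nat \<Rightarrow> 'w \<Rightarrow> 'n set"
    and r :: "nat \<Rightarrow> 'w \<Rightarrow> 'n"
    and q :: "nat \<Rightarrow> 'w \<Rightarrow> nat ^ 'n"
  assumes measurable_q: "\<And>k. random_variable (count_space UNIV) (q k)"
    and measurable_D: "\<And>k. random_variable (count_space UNIV) (D k)"
    and measurable_r: "\<And>k. random_variable (count_space UNIV) (r k)"
    and arrivals_iid: "iid (count_space UNIV) a"
    and services_iid: "iid (count_space UNIV) s"
    and arrivals_services_indep:
      "indep_rv (Pi\<^sub>M UNIV (\<lambda>_. count_space UNIV)) (\<lambda>\<omega> k. a k \<omega>)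
                (Pi\<^sub>M UNIV (\<lambda>_. count_space UNIV)) (\<lambda>\<omega> k. s k \<omega>)"
    and arrivals_history_indep:
      "\<And>k. indep_rv (count_space UNIV) (a k) (count_space UNIV) (queue_history q k)"
    and services_history_indep:
      "\<And>k. indep_rv (count_space UNIV) (s k)
         (count_space UNIV) (\<lambda>\<omega>. (queue_history q k \<omega>, a k \<omega>, D k \<omega>, r k \<omega>))"
    and selection:
      "\<And>k. uniform_given (\<lambda>\<omega>. (queue_history q k \<omega>, a k \<omega>)) (\<lambda>_. {S. card S = d}) (D k)"
    and routing:
      "\<And>k. uniform_given (\<lambda>\<omega>. (queue_history q k \<omega>, a k \<omega>, D k \<omega>))
         (\<lambda>(h, x, S). shortest (last h) S) (r k)"
    and queue_dynamics:
      "\<And>k \<omega> i. \<omega> \<in> space M \<Longrightarrow>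
         int (q (Suc k) \<omega> $ i) = int (q k \<omega> $ i) + int (routed a r k \<omega> i)
           - int (s k \<omega> $ i) + unused a s r q k \<omega> i"

end

theory Submission
  imports Defs
begin

text \<open>
  Let \<open>T\<close> be the identity or \<^const>\<open>perp\<close>. By the layer-cake formula the queue length vector \<open>x\<close> is
  the sum of the indicators of its upper level sets \<open>U\<close>, so both \<open>norm (T x)\<close> and the drift of its
  square are controlled level by level. The arrivals are routed into \<open>U\<close> iff all the selected queues
  lie in \<open>U\<close>, which has probability \<open>(card U choose d) / (n choose d)\<close>; the sum of \<open>\<mu>\<close> over \<open>U\<close>
  exceeds \<open>\<mu>\<^sub>\<Sigma>\<close> times this probability by at least \<open>\<delta> \<mu>\<^sub>\<Sigma>\<close> if \<open>d \<le> card U < n\<close>, and is bounded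
  away from \<open>0\<close> if \<open>card U < d\<close>. The drift of \<open>norm (T x)\<close> is therefore at most a fixed negative
  constant outside a fixed ball, for \<open>T = perp\<close> if \<open>\<epsilon>\<close> is small, and for \<open>T = id\<close> if \<open>\<epsilon>\<close> is bounded
  away from \<open>0\<close>. The choice \<open>T = perp\<close> alone does not suffice: when \<open>\<epsilon> / n\<close> exceeds the smallest service
  rate, a long queue at the slowest server shrinks more slowly than the average queue.
  As the increments are bounded, Hajek's argument bounds an exponential moment of \<open>norm (T x)\<close>
  uniformly in \<open>\<epsilon>\<close>. Since the initial distribution is arbitrary, the argument is run on the event
  that the initial state is bounded; truncation then carries the bound over to the weak limit.
\<close>

section \<open>Projections, level sets and order statistics\<close>

text \<open>The weight \<open>c\<close> lets one drift argument serve both projections: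
  \<open>c = 0\<close> is the identity and \<open>c = 1\<close> is \<open>perp\<close>.\<close>

definition collapse :: "real \<Rightarrow> real ^ 'n \<Rightarrow> real ^ 'n" where
  "collapse c x = x - c *\<^sub>R parallel x"

definition ind_vec :: "'n::finite set \<Rightarrow> real ^ 'n" where
  "ind_vec U = (\<chi> i. indicator U i)"

lemma entry_sum_add: "entry_sum (x + y) = entry_sum x + entry_sum y"
  and entry_sum_scaleR: "entry_sum (b *\<^sub>R x) = b * entry_sum x"
  and entry_sum_diff: "entry_sum (x - y) = entry_sum x - entry_sum y"
  by (simp_all add: entry_sum_def sum.distrib sum_distrib_left sum_subtractf)

lemma entry_sum_one: "entry_sum (1 :: real ^ 'n) = real CARD('n)"
  by (simp add: entry_sum_def)

lemma one_inner_vec: "(1 :: real ^ 'n) \<bullet> x = entry_sum x"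
  by (simp add: entry_sum_def inner_vec_def)

lemma linear_collapse: "linear (collapse c)"
  by (rule linearI)
     (simp_all add: collapse_def parallel_def entry_sum_add entry_sum_scaleR algebra_simps
       add_divide_distrib)

lemma continuous_collapse: "continuous_on UNIV (collapse c)"
  by (simp add: linear_continuous_on linear_collapse linear_conv_bounded_linear[symmetric])

lemma borel_measurable_collapse [measurable]: "collapse c \<in> borel_measurable borel"
  by (rule borel_measurable_continuous_onI) (rule continuous_collapse)

lemma collapse_0 [simp]: "collapse 0 x = x"
  and collapse_1: "collapse 1 x = perp x"
  by (simp_all add: collapse_def perp_def)

lemma inner_collapse:
  fixes x y :: "real ^ 'n"
  shows "collapse c x \<bullet> y = x \<bullet> y - c * entry_sum x * entry_sum y / real CARD('n)"
  by (simp add: collapse_def parallel_def inner_diff_left one_inner_vec)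

text \<open>For these two weights the map is an orthogonal projection, self-adjoint and idempotent.
  Hence the raw increment of the queues can be paired with the projected state.\<close>

lemma collapse_inner_collapse:
  assumes "c \<in> {0, 1}"
  shows "collapse c x \<bullet> collapse c y = collapse c x \<bullet> y"
  using assms
  by (auto simp: collapse_1 perp_def parallel_def inner_diff_left inner_diff_right one_inner_vec
      entry_sum_diff entry_sum_scaleR entry_sum_one inner_commute[of x 1])

lemma norm_collapse_le:
  assumes "c \<in> {0, 1}"
  shows "norm (collapse c x) \<le> norm x"
proof (cases "collapse c x = 0")
  case False
  have "norm (collapse c x) * norm (collapse c x) = collapse c x \<bullet> x"
    using collapse_inner_collapse[OF assms, of x x] by (metis norm_eq_square power2_eq_square power2_norm_eq_inner)
  also have "\<dots> \<le> norm (collapse c x) * norm x"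
    by (rule norm_cauchy_schwarz)
  finally show ?thesis using False by simp
qed simp

text \<open>Whichever projection the drift argument controls, its bound passes to
  \<open>perp\<close>.\<close>

lemma norm_perp_le_collapse:
  assumes "c \<in> {0, 1}"
  shows "norm (perp x) \<le> norm (collapse c x)"
  using assms norm_collapse_le[of 1 x] by (auto simp: collapse_1)

lemma norm_vec_le:
  fixes x :: "real ^ 'n"
  assumes "\<And>i. \<bar>x $ i\<bar> \<le> b"
  shows "norm x \<le> real CARD('n) * b"
proof -
  have "norm x \<le> (\<Sum>i\<in>UNIV. \<bar>x $ i\<bar>)" by (rule norm_le_l1_cart)
  also have "\<dots> \<le> (\<Sum>i\<in>(UNIV :: 'n set). b)" by (rule sum_mono) (rule assms)
  finally show ?thesis by simp
qed

section \<open>Indicator vectors of sets of servers and the layer-cake formula\<close>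

lemma norm_collapse_ind_vec_le:
  assumes "c \<in> {0, 1}"
  shows "norm (collapse c (ind_vec (U :: 'n::finite set))) \<le> real CARD('n)"
proof -
  have "norm (ind_vec U) \<le> real CARD('n) * 1"
    by (rule norm_vec_le) (simp add: ind_vec_def indicator_def)
  then show ?thesis using norm_collapse_le[OF assms, of "ind_vec U"] by simp
qed

lemma collapse_ind_vec_empty: "collapse c (ind_vec {}) = 0"
  by (simp add: collapse_def parallel_def ind_vec_def entry_sum_def vec_eq_iff)

lemma perp_ind_vec_UNIV: "perp (ind_vec UNIV) = 0"
  by (simp add: perp_def parallel_def ind_vec_def entry_sum_def vec_eq_iff)

lemma inner_ind_vec: "ind_vec U \<bullet> x = (\<Sum>i\<in>U. x $ i)"
  by (simp add: inner_vec_def ind_vec_def indicator_def if_distrib[of "\<lambda>y. y * _"] sum.If_cases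
      cong: if_cong)

lemma entry_sum_ind_vec: "entry_sum (ind_vec U) = real (card U)"
  by (simp add: entry_sum_def ind_vec_def indicator_def sum.If_cases)

text \<open>Entry \<open>i\<close> counts the thresholds \<open>t < x $ i\<close>. Any common bound
  \<open>N\<close> serves, because levels from the maximum upwards are empty.\<close>

lemma real_vec_layer_cake:
  assumes "\<And>i. x $ i \<le> N"
  shows "real_vec x = (\<Sum>t<N. ind_vec {i. t < x $ i})"
proof -
  have "{t. t < N \<and> t < x $ i} = {..<x $ i}" for i using assms[of i] by auto
  then have "(\<Sum>t<N. indicator {i. t < x $ i} i) = real (x $ i)" for i
    by (simp add: indicator_def sum.If_cases flip: Collect_conj_eq) (simp add: Int_def)
  then show ?thesis
    by (simp add: vec_eq_iff real_vec_def ind_vec_def)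
qed

text \<open>Induction on the list: the head \<open>y\<close> is matched with some
  \<open>z \<ge> y\<close> removed from \<open>N\<close>, and what remains of \<open>N\<close> fits
  into the tail.\<close>

lemma sum_list_take_le_sum_mset:
  fixes xs :: "real list"
  assumes "sorted xs" and "N \<subseteq># mset xs" and "size N = j"
  shows "sum_list (take j xs) \<le> sum_mset N"
  using assms
proof (induction xs arbitrary: N j)
  case (Cons y ys)
  show ?case
  proof (cases j)
    case 0
    then show ?thesis using Cons.prems by simp
  next
    case (Suc j')
    \<comment> \<open>\<open>z\<close> is \<open>y\<close> itself if it occurs in \<open>N\<close>.
      Otherwise \<open>N\<close> already lies in the tail, whose elements are all at least
      \<open>y\<close>, and any element of \<open>N\<close> serves.\<close>
    obtain z where z: "z \<in># N" and sub: "N - {#z#} \<subseteq># mset ys" and "y \<le> z"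
    proof (cases "y \<in># N")
      case True
      then show ?thesis using that[of y] Cons.prems
        by (metis add_mset_remove_trivial mset.simps(2) subset_eq_diff_conv order_refl
            add_mset_add_single)
    next
      case False
      then have N: "N \<subseteq># mset ys" using Cons.prems(2)
        by (metis mset.simps(2) add_mset_add_single diff_single_trivial subset_eq_diff_conv)
      obtain z where z: "z \<in># N" using Cons.prems(3) Suc
        by (metis size_eq_Suc_imp_elem)
      then have "z \<in> set ys" using N by (metis mset_subset_eqD set_mset_mset)
      then show ?thesis using that[of z] z N Cons.prems(1)
        by (meson diff_subset_eq_self order_trans sorted_simps(2) subset_mset.order_trans)
    qed
    have "sum_list (take j' ys) \<le> sum_mset (N - {#z#})"
    proof (rule Cons.IH)
      show "sorted ys" using Cons.prems(1) by simp
      show "size (N - {#z#}) = j'" using z Suc Cons.prems(3) by (simp add: size_Diff_singleton)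
    qed (rule sub)
    moreover have "sum_mset N = z + sum_mset (N - {#z#})"
      using z by (rule sum_mset.remove)
    ultimately show ?thesis using \<open>y \<le> z\<close> by (simp add: Suc)
  qed
qed simp

text \<open>The entries indexed by \<open>U\<close> form a sub-multiset of all entries, so the
  previous lemma applies to the sorted list. This turns a condition on order statistics into one on
  every set of servers.\<close>

lemma sum_order_stat_le:
  fixes \<mu> :: "real ^ 'n"
  shows "(\<Sum>i=1..card U. order_stat \<mu> i) \<le> (\<Sum>i\<in>U. \<mu> $ i)"
proof -
  define xs where "xs = sorted_list_of_multiset (image_mset (\<lambda>j. \<mu> $ j) (mset_set UNIV))"
  have mset_xs: "mset xs = image_mset (\<lambda>j. \<mu> $ j) (mset_set UNIV)" by (simp add: xs_def)
  have len: "length xs = CARD('n)" using arg_cong[OF mset_xs, of size] by simp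
  \<comment> \<open>Order statistics are numbered from 1, list positions from 0.\<close>
  have "(\<Sum>i=1..card U. order_stat \<mu> i) = (\<Sum>i<card U. xs ! i)"
    unfolding order_stat_def xs_def[symmetric]
    by (rule sum.reindex_bij_witness[of _ Suc "\<lambda>i. i - 1"]) auto
  also have "\<dots> = sum_list (take (card U) xs)"
    using card_mono[of UNIV U] len by (simp add: sum_list_sum_nth atLeast0LessThan)
  also have "\<dots> \<le> sum_mset (image_mset (\<lambda>j. \<mu> $ j) (mset_set U))"
    by (rule sum_list_take_le_sum_mset)
       (auto simp: xs_def intro!: image_mset_subseteq_mono subset_imp_msubset_mset_set)
  finally show ?thesis by (simp add: sum_unfold_sum_mset)
qed

text \<open>A ball around \<open>\<mu>\<close> inside the region contains \<open>\<mu>\<close>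
  lowered by the radius in coordinate \<open>i\<close>, and that coordinate is still
  nonnegative.\<close>

lemma interior_capacity_region_pos:
  assumes "\<mu> \<in> interior (capacity_region d)"
  shows "0 < \<mu> $ i"
proof -
  obtain e where e: "e > 0" "cball \<mu> e \<subseteq> capacity_region d"
    using assms unfolding mem_interior_cball by blast
  have "\<mu> - e *\<^sub>R axis i 1 \<in> cball \<mu> e" using e by (simp add: dist_norm norm_axis_1)
  then have "0 \<le> (\<mu> - e *\<^sub>R axis i 1) $ i" using e(2) unfolding capacity_region_def by blast
  then show ?thesis using e(1) by simp
qed

section \<open>Discrete random variables\<close>

context prob_space
begin

lemma indep_rv_prob:
  assumes "indep_rv S X T Y" and "A \<in> sets S" and "B \<in> sets T"
  shows "prob ((X -` A \<inter> space M) \<inter> (Y -` B \<inter> space M)) =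
    prob (X -` A \<inter> space M) * prob (Y -` B \<inter> space M)"
  using assms unfolding indep_rv_def by (blast intro: indep_setD)

text \<open>Each pair \<open>(x, y)\<close> with \<open>y\<close> outside \<open>A x\<close> has
  probability zero; as both types are countable, all these pairs can be excluded at once.\<close>

lemma uniform_given_AE:
  fixes X :: "'a \<Rightarrow> 'b::countable" and Y :: "'a \<Rightarrow> 'c::countable"
  assumes [measurable]: "X \<in> M \<rightarrow>\<^sub>M count_space UNIV" "Y \<in> M \<rightarrow>\<^sub>M count_space UNIV"
    and unif: "uniform_given X A Y"
  shows "AE \<omega> in M. Y \<omega> \<in> A (X \<omega>)"
proof -
  have "AE \<omega> in M. X \<omega> = x \<longrightarrow> Y \<omega> = y \<longrightarrow> y \<in> A x" for x y
  proof (cases "y \<in> A x")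
    case False
    have "{\<omega>\<in>space M. X \<omega> = x \<and> Y \<omega> = y} \<in> null_sets M"
      using unif False unfolding uniform_given_def
      by (intro null_setsI) (auto simp: emeasure_eq_measure)
    then show ?thesis by (rule AE_I') auto
  qed simp
  then have "AE \<omega> in M. \<forall>x y. X \<omega> = x \<longrightarrow> Y \<omega> = y \<longrightarrow> y \<in> A x"
    unfolding AE_all_countable by blast
  then show ?thesis by eventually_elim auto
qed

lemma uniform_given_prob:
  fixes Y :: "'a \<Rightarrow> 'c::finite"
  assumes [measurable]: "X \<in> M \<rightarrow>\<^sub>M count_space UNIV" "Y \<in> M \<rightarrow>\<^sub>M count_space UNIV"
    and unif: "uniform_given X A Y"
  shows "prob {\<omega>\<in>space M. X \<omega> = x \<and> Y \<omega> \<in> B} =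
    prob {\<omega>\<in>space M. X \<omega> = x} * (real (card (A x \<inter> B)) / real (card (A x)))"
proof -
  have "prob {\<omega>\<in>space M. X \<omega> = x \<and> Y \<omega> \<in> B} =
      prob (\<Union>y\<in>B. {\<omega>\<in>space M. X \<omega> = x \<and> Y \<omega> = y})"
    by (rule arg_cong[where f = prob]) auto
  also have "\<dots> = (\<Sum>y\<in>B. prob {\<omega>\<in>space M. X \<omega> = x \<and> Y \<omega> = y})"
    by (rule finite_measure_finite_Union) (auto simp: disjoint_family_on_def)
  also have "\<dots> = (\<Sum>y\<in>B. prob {\<omega>\<in>space M. X \<omega> = x} *
      (if y \<in> A x then 1 / real (card (A x)) else 0))"
    using unif unfolding uniform_given_def by simp
  also have "\<dots> = prob {\<omega>\<in>space M. X \<omega> = x} * (real (card (A x \<inter> B)) / real (card (A x)))"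
    by (simp add: sum_distrib_left[symmetric] sum.If_cases Int_commute)
  finally show ?thesis .
qed

lemma integrable_indicator_bounded_nat:
  fixes Z :: "'a \<Rightarrow> nat"
  assumes [measurable]: "Z \<in> M \<rightarrow>\<^sub>M count_space UNIV" "A \<in> events"
    and "AE \<omega> in M. Z \<omega> \<le> b"
  shows "integrable M (\<lambda>\<omega>. indicator A \<omega> * real (Z \<omega>))"
proof (rule integrable_const_bound)
  show "AE \<omega> in M. norm (indicator A \<omega> * real (Z \<omega>)) \<le> real b"
    using assms(3) by eventually_elim (simp add: indicator_def)
qed simp

lemma integral_indicator_bounded_nat:
  fixes Z :: "'a \<Rightarrow> nat"
  assumes [measurable]: "Z \<in> M \<rightarrow>\<^sub>M count_space UNIV" "A \<in> events"
    and "AE \<omega> in M. Z \<omega> \<le> b"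
  shows "(\<integral>\<omega>. indicator A \<omega> * real (Z \<omega>) \<partial>M) =
    (\<Sum>y\<le>b. real y * prob {\<omega>\<in>space M. \<omega> \<in> A \<and> Z \<omega> = y})"
proof -
  have "(\<integral>\<omega>. indicator A \<omega> * real (Z \<omega>) \<partial>M) =
      (\<integral>\<omega>. (\<Sum>y\<le>b. real y * indicator {\<omega>\<in>space M. \<omega> \<in> A \<and> Z \<omega> = y} \<omega>) \<partial>M)"
  proof (rule integral_cong_AE)
    show "AE \<omega> in M. indicator A \<omega> * real (Z \<omega>) =
        (\<Sum>y\<le>b. real y * indicator {\<omega>\<in>space M. \<omega> \<in> A \<and> Z \<omega> = y} \<omega>)"
      using assms(3) AE_space
    proof eventually_elim
      case (elim \<omega>)
      have "(\<Sum>y\<le>b. real y * indicator {\<omega>\<in>space M. \<omega> \<in> A \<and> Z \<omega> = y} \<omega>) =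
          (\<Sum>y\<le>b. if y = Z \<omega> then indicator A \<omega> * real (Z \<omega>) else 0)"
        using elim by (intro sum.cong) (auto simp: indicator_def)
      then show ?case using elim by simp
    qed
  qed measurable
  also have "\<dots> = (\<Sum>y\<le>b. real y * prob {\<omega>\<in>space M. \<omega> \<in> A \<and> Z \<omega> = y})"
  proof (subst Bochner_Integration.integral_sum)
    show "integrable M (\<lambda>\<omega>. real y * indicator {\<omega>\<in>space M. \<omega> \<in> A \<and> Z \<omega> = y} \<omega>)" for y
      by (intro integrable_mult_right integrable_real_indicator) (auto simp: less_top[symmetric])
  qed simp
  finally show ?thesis .
qed

text \<open>A bounded integer variable is a finite combination of indicators of its values, so it
  suffices to factor the probabilities of single values. Independence and the uniform selection
  enter the means in this form.\<close>

lemma integral_indicator_proportional: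
  fixes Z :: "'a \<Rightarrow> nat"
  assumes Z: "Z \<in> M \<rightarrow>\<^sub>M count_space UNIV" "AE \<omega> in M. Z \<omega> \<le> b" and A: "A \<in> events"
    and proportional: "\<And>y. prob {\<omega>\<in>space M. \<omega> \<in> A \<and> Z \<omega> = y} = p * prob {\<omega>\<in>space M. Z \<omega> = y}"
  shows "(\<integral>\<omega>. indicator A \<omega> * real (Z \<omega>) \<partial>M) = p * (\<integral>\<omega>. real (Z \<omega>) \<partial>M)"
proof -
  have "(\<integral>\<omega>. real (Z \<omega>) \<partial>M) = (\<integral>\<omega>. indicator (space M) \<omega> * real (Z \<omega>) \<partial>M)"
    by (rule Bochner_Integration.integral_cong) auto
  also have "\<dots> = (\<Sum>y\<le>b. real y * prob {\<omega>\<in>space M. Z \<omega> = y})"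
    by (subst integral_indicator_bounded_nat[OF Z(1) _ Z(2)])
       (auto intro!: sum.cong arg_cong[where f = prob])
  finally show ?thesis
    unfolding integral_indicator_bounded_nat[OF Z(1) A Z(2)] proportional
    by (simp add: sum_distrib_left mult_ac)
qed

text \<open>Stands in for conditioning on \<open>X\<close>: the comparison is made on each atom
  \<open>X = x\<close> and summed over the countably many atoms. Extended nonnegative integrals make
  this possible without integrability.\<close>

lemma nn_integral_mono_discrete:
  fixes X :: "'a \<Rightarrow> 'b::countable" and f g :: "'a \<Rightarrow> ennreal"
  assumes [measurable]: "X \<in> M \<rightarrow>\<^sub>M count_space UNIV" "f \<in> borel_measurable M" "g \<in> borel_measurable M"
    and le: "\<And>x. (\<integral>\<^sup>+\<omega>. f \<omega> * indicator {\<omega>\<in>space M. X \<omega> = x} \<omega> \<partial>M) \<le>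
      (\<integral>\<^sup>+\<omega>. g \<omega> * indicator {\<omega>\<in>space M. X \<omega> = x} \<omega> \<partial>M)"
  shows "(\<integral>\<^sup>+\<omega>. f \<omega> \<partial>M) \<le> (\<integral>\<^sup>+\<omega>. g \<omega> \<partial>M)"
proof -
  \<comment> \<open>\<open>to_nat\<close> numbers the atoms, so that the integral becomes a series;
    numbers outside its range give empty atoms.\<close>
  define A where "A i = {\<omega>\<in>space M. to_nat (X \<omega>) = i}" for i
  have [measurable]: "A i \<in> events" for i unfolding A_def by measurable
  have decomp: "(\<integral>\<^sup>+\<omega>. h \<omega> \<partial>M) = (\<Sum>i. \<integral>\<^sup>+\<omega>. h \<omega> * indicator (A i) \<omega> \<partial>M)"
    if [measurable]: "h \<in> borel_measurable M" for h :: "'a \<Rightarrow> ennreal"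
  proof -
    have "(\<Sum>i. h \<omega> * indicator (A i) \<omega>) = h \<omega>" if "\<omega> \<in> space M" for \<omega>
      using suminf_cmult_indicator[of A \<omega> "to_nat (X \<omega>)" "\<lambda>_. h \<omega>"] that
      by (auto simp: A_def disjoint_family_on_def)
    then have "(\<integral>\<^sup>+\<omega>. h \<omega> \<partial>M) = (\<integral>\<^sup>+\<omega>. (\<Sum>i. h \<omega> * indicator (A i) \<omega>) \<partial>M)"
      by (intro nn_integral_cong) simp
    also have "\<dots> = (\<Sum>i. \<integral>\<^sup>+\<omega>. h \<omega> * indicator (A i) \<omega> \<partial>M)"
      by (rule nn_integral_suminf) measurable
    finally show ?thesis .
  qed
  have "(\<integral>\<^sup>+\<omega>. f \<omega> * indicator (A i) \<omega> \<partial>M) \<le> (\<integral>\<^sup>+\<omega>. g \<omega> * indicator (A i) \<omega> \<partial>M)" for i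
  proof (cases "\<exists>x::'b. i = to_nat x")
    case True
    then obtain x :: 'b where "i = to_nat x" by blast
    then have "A i = {\<omega>\<in>space M. X \<omega> = x}" by (auto simp: A_def)
    then show ?thesis using le[of x] by simp
  next
    case False
    then have "A i = {}" by (auto simp: A_def)
    then show ?thesis by simp
  qed
  then show ?thesis unfolding decomp[OF assms(2)] decomp[OF assms(3)]
    by (intro suminf_le) auto
qed

end

section \<open>One slot of the system\<close>

lemma card_subsets_within:
  fixes U :: "'n::finite set"
  shows "card ({S :: 'n set. card S = d} \<inter> {S. S \<subseteq> U}) = card U choose d"
proof -
  have "{S :: 'n set. card S = d} \<inter> {S. S \<subseteq> U} = {S. S \<subseteq> U \<and> card S = d}" by auto
  then show ?thesis by (simp add: n_subsets)
qed

context power_of_d_system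
begin

lemma measurable_a: "a k \<in> M \<rightarrow>\<^sub>M count_space UNIV"
  and measurable_queue_history: "queue_history q k \<in> M \<rightarrow>\<^sub>M count_space UNIV"
  using arrivals_history_indep[of k] by (simp_all add: indep_rv_def)

lemma measurable_s: "s k \<in> M \<rightarrow>\<^sub>M count_space UNIV"
  using services_history_indep[of k] by (simp add: indep_rv_def)

lemmas measurable_system [measurable] =
  measurable_q measurable_D measurable_r measurable_a measurable_queue_history measurable_s

text \<open>The means are prescribed in slot 1; identical distribution carries them to every
  slot.\<close>

lemma mean_stationary:
  assumes "iid (count_space UNIV) X"
  shows "(\<integral>\<omega>. f (X k \<omega>) \<partial>M) = (\<integral>\<omega>. f (X 1 \<omega>) \<partial>M :: real)"
proof -
  have [measurable]: "X j \<in> M \<rightarrow>\<^sub>M count_space UNIV" for j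
    using assms by (auto simp: iid_def indep_vars_def)
  have "(\<integral>\<omega>. f (X j \<omega>) \<partial>M) = (\<integral>x. f x \<partial>distr M (count_space UNIV) (X j))" for j
    by (subst integral_distr) auto
  moreover have "distr M (count_space UNIV) (X k) = distr M (count_space UNIV) (X 1)"
    using assms unfolding iid_def by metis
  ultimately show ?thesis by simp
qed

section \<open>Means of arrivals and services on a fixed queue history\<close>

lemma prob_history_arrivals:
  "prob {\<omega>\<in>space M. queue_history q k \<omega> = h \<and> a k \<omega> = y} =
    prob {\<omega>\<in>space M. queue_history q k \<omega> = h} * prob {\<omega>\<in>space M. a k \<omega> = y}"
proof -
  have "{\<omega>\<in>space M. queue_history q k \<omega> = h \<and> a k \<omega> = y} =
      (a k -` {y} \<inter> space M) \<inter> (queue_history q k -` {h} \<inter> space M)" by auto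
  then have "prob {\<omega>\<in>space M. queue_history q k \<omega> = h \<and> a k \<omega> = y} =
      prob (a k -` {y} \<inter> space M) * prob (queue_history q k -` {h} \<inter> space M)"
    using indep_rv_prob[OF arrivals_history_indep, of "{y}" "{h}" k] by simp
  also have "a k -` {y} \<inter> space M = {\<omega>\<in>space M. a k \<omega> = y}" by auto
  also have "queue_history q k -` {h} \<inter> space M = {\<omega>\<in>space M. queue_history q k \<omega> = h}" by auto
  finally show ?thesis by simp
qed

lemma integral_services:
  assumes "AE \<omega> in M. s k \<omega> $ i \<le> b"
  shows "(\<integral>\<omega>. indicator {\<omega>\<in>space M. queue_history q k \<omega> = h} \<omega> * real (s k \<omega> $ i) \<partial>M) =
    prob {\<omega>\<in>space M. queue_history q k \<omega> = h} * (\<integral>\<omega>. real (s 1 \<omega> $ i) \<partial>M)"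
proof -
  have "prob {\<omega>\<in>space M. \<omega> \<in> {\<omega>\<in>space M. queue_history q k \<omega> = h} \<and> s k \<omega> $ i = y} =
    prob {\<omega>\<in>space M. queue_history q k \<omega> = h} * prob {\<omega>\<in>space M. s k \<omega> $ i = y}" for y
  proof -
    \<comment> \<open>Independence from the whole tuple is applied to an event that depends on its
      first component only.\<close>
    let ?Y = "\<lambda>\<omega>. (queue_history q k \<omega>, a k \<omega>, D k \<omega>, r k \<omega>)"
    have "prob ((s k -` {v. v $ i = y} \<inter> space M) \<inter> (?Y -` {(h', _). h' = h} \<inter> space M)) =
        prob (s k -` {v. v $ i = y} \<inter> space M) * prob (?Y -` {(h', _). h' = h} \<inter> space M)"
      by (rule indep_rv_prob[OF services_history_indep]) auto
    moreover have "s k -` {v. v $ i = y} \<inter> space M = {\<omega>\<in>space M. s k \<omega> $ i = y}"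
      "?Y -` {(h', _). h' = h} \<inter> space M = {\<omega>\<in>space M. queue_history q k \<omega> = h}"
      by auto
    moreover have "{\<omega>\<in>space M. s k \<omega> $ i = y} \<inter> {\<omega>\<in>space M. queue_history q k \<omega> = h} =
        {\<omega>\<in>space M. \<omega> \<in> {\<omega>\<in>space M. queue_history q k \<omega> = h} \<and> s k \<omega> $ i = y}"
      by auto
    ultimately show ?thesis by (simp add: mult.commute)
  qed
  then have "(\<integral>\<omega>. indicator {\<omega>\<in>space M. queue_history q k \<omega> = h} \<omega> * real (s k \<omega> $ i) \<partial>M) =
      prob {\<omega>\<in>space M. queue_history q k \<omega> = h} * (\<integral>\<omega>. real (s k \<omega> $ i) \<partial>M)"
    using assms by (intro integral_indicator_proportional) auto
  also have "(\<integral>\<omega>. real (s k \<omega> $ i) \<partial>M) = (\<integral>\<omega>. real (s 1 \<omega> $ i) \<partial>M)"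
    by (rule mean_stationary[OF services_iid])
  finally show ?thesis .
qed

lemma AE_routed_shortest: "AE \<omega> in M. r k \<omega> \<in> shortest (q k \<omega>) (D k \<omega>)"
proof -
  have "AE \<omega> in M. r k \<omega> \<in> (case (queue_history q k \<omega>, a k \<omega>, D k \<omega>) of
      (h, x, S) \<Rightarrow> shortest (last h) S)"
    by (rule uniform_given_AE[OF _ _ routing]) measurable
  \<comment> \<open>The last entry of the history up to slot \<open>k\<close> is the current state
    \<open>q k\<close>.\<close>
  then show ?thesis by (simp add: queue_history_def)
qed

text \<open>A shortest selected queue is longer than \<open>t\<close> iff all selected queues are, so the way ties
  are broken does not matter.\<close>

lemma AE_routed_iff_selected:
  "AE \<omega> in M. t < q k \<omega> $ (r k \<omega>) \<longleftrightarrow> D k \<omega> \<subseteq> {i. t < q k \<omega> $ i}"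
  using AE_routed_shortest[of k]
  by eventually_elim (fastforce simp: shortest_def)

text \<open>On a fixed history the level set is fixed, and arrivals enter it almost surely iff the
  selected set lies inside. The selection is uniform given history and arrivals, and the arrivals
  are independent of the history, so the integral splits into three factors.\<close>

lemma integral_routed_arrivals:
  assumes "AE \<omega> in M. a k \<omega> \<le> b"
  shows "(\<integral>\<omega>. indicator {\<omega>\<in>space M. queue_history q k \<omega> = h} \<omega> *
        real (if t < last h $ (r k \<omega>) then a k \<omega> else 0) \<partial>M) =
    prob {\<omega>\<in>space M. queue_history q k \<omega> = h} *
      (real (card {i. t < last h $ i} choose d) / real (CARD('n) choose d)) *
      (\<integral>\<omega>. real (a 1 \<omega>) \<partial>M)"
proof -
  define U where "U = {i. t < last h $ i}"
  \<comment> \<open>The event is stated through the selection \<open>D k\<close> instead of the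
    routing \<open>r k\<close>; \<open>AE_routed_iff_selected\<close> identifies the two at the
    end.\<close>
  define A where "A = {\<omega>\<in>space M. queue_history q k \<omega> = h \<and> D k \<omega> \<subseteq> U}"
  define \<beta> where "\<beta> = real (card U choose d) / real (CARD('n) choose d)"
  have [measurable]: "A \<in> events" unfolding A_def by measurable
  have "prob {\<omega>\<in>space M. \<omega> \<in> A \<and> a k \<omega> = y} =
      prob {\<omega>\<in>space M. queue_history q k \<omega> = h} * \<beta> * prob {\<omega>\<in>space M. a k \<omega> = y}" for y
  proof -
    have "{\<omega>\<in>space M. \<omega> \<in> A \<and> a k \<omega> = y} =
        {\<omega>\<in>space M. (queue_history q k \<omega>, a k \<omega>) = (h, y) \<and> D k \<omega> \<in> {S. S \<subseteq> U}}"
      by (auto simp: A_def)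
    moreover have "prob {\<omega>\<in>space M. (queue_history q k \<omega>, a k \<omega>) = (h, y) \<and> D k \<omega> \<in> {S. S \<subseteq> U}} =
        prob {\<omega>\<in>space M. (queue_history q k \<omega>, a k \<omega>) = (h, y)} * \<beta>"
      using card_subsets_within[of d U] card_subsets_within[of d "UNIV :: 'n set"]
      by (subst uniform_given_prob[OF _ _ selection]) (simp_all add: \<beta>_def)
    ultimately show ?thesis using prob_history_arrivals[of k h y] by simp
  qed
  then have "(\<integral>\<omega>. indicator A \<omega> * real (a k \<omega>) \<partial>M) =
      prob {\<omega>\<in>space M. queue_history q k \<omega> = h} * \<beta> * (\<integral>\<omega>. real (a k \<omega>) \<partial>M)"
    using assms by (intro integral_indicator_proportional) auto
  also have "(\<integral>\<omega>. real (a k \<omega>) \<partial>M) = (\<integral>\<omega>. real (a 1 \<omega>) \<partial>M)"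
    by (rule mean_stationary[OF arrivals_iid])
  also have "(\<integral>\<omega>. indicator A \<omega> * real (a k \<omega>) \<partial>M) =
      (\<integral>\<omega>. indicator {\<omega>\<in>space M. queue_history q k \<omega> = h} \<omega> *
        real (if t < last h $ (r k \<omega>) then a k \<omega> else 0) \<partial>M)"
  proof (rule integral_cong_AE)
    show "AE \<omega> in M. indicator A \<omega> * real (a k \<omega>) =
        indicator {\<omega>\<in>space M. queue_history q k \<omega> = h} \<omega> *
        real (if t < last h $ (r k \<omega>) then a k \<omega> else 0)"
      using AE_routed_iff_selected[of t k] AE_space
      by eventually_elim (auto simp: A_def U_def indicator_def queue_history_def)
  qed measurable
  finally show ?thesis by (simp add: \<beta>_def U_def)
qed

lemma integral_arrivals:
  assumes "AE \<omega> in M. a k \<omega> \<le> b"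
  shows "(\<integral>\<omega>. indicator {\<omega>\<in>space M. queue_history q k \<omega> = h} \<omega> * real (a k \<omega>) \<partial>M) =
    prob {\<omega>\<in>space M. queue_history q k \<omega> = h} * (\<integral>\<omega>. real (a 1 \<omega>) \<partial>M)"
proof -
  have "(\<integral>\<omega>. indicator {\<omega>\<in>space M. queue_history q k \<omega> = h} \<omega> * real (a k \<omega>) \<partial>M) =
      prob {\<omega>\<in>space M. queue_history q k \<omega> = h} * (\<integral>\<omega>. real (a k \<omega>) \<partial>M)"
    using assms prob_history_arrivals by (intro integral_indicator_proportional) auto
  also have "(\<integral>\<omega>. real (a k \<omega>) \<partial>M) = (\<integral>\<omega>. real (a 1 \<omega>) \<partial>M)"
    by (rule mean_stationary[OF arrivals_iid])
  finally show ?thesis .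
qed

end

section \<open>Negative drift and exponential moments\<close>

lemma exp_le_quadratic:
  fixes x :: real
  assumes "\<bar>x\<bar> \<le> 1"
  shows "exp x \<le> 1 + x + x\<^sup>2"
proof (cases "0 \<le> x")
  case True
  then show ?thesis using exp_bound[of x] assms by simp
next
  case False
  define y where "y = - x"
  have y: "0 < y" using False by (simp add: y_def)
  \<comment> \<open>The product is \<open>1 + y ^ 3\<close>. Replacing \<open>1 + y\<close> by the
    larger \<open>exp y\<close> then bounds \<open>exp (- y)\<close> from above.\<close>
  have "1 \<le> (1 + y) * (1 - y + y\<^sup>2)"
    using y by (simp add: algebra_simps power2_eq_square)
  also have "\<dots> \<le> exp y * (1 - y + y\<^sup>2)"
  proof (rule mult_right_mono)
    have "0 \<le> (1 - y)\<^sup>2 + y" using y by (simp add: add_nonneg_nonneg)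
    then show "0 \<le> 1 - y + y\<^sup>2" using y by (simp add: power2_eq_square algebra_simps)
  qed simp
  finally show ?thesis
    by (simp add: y_def exp_minus field_simps)
qed

text \<open>The projection is the identity for \<open>c = 0\<close> and \<^const>\<open>perp\<close> for \<open>c = 1\<close>.\<close>

locale drift_system = power_of_d_system M d a s D r q
  for M :: "'w measure" and d a s and D :: "nat \<Rightarrow> 'w \<Rightarrow> 'n::finite set" and r q +
  fixes A S :: nat and c \<eta> :: real and \<mu> :: "real ^ 'n" and L K \<theta> :: real
  assumes a_bound: "\<And>k. AE \<omega> in M. a k \<omega> \<le> A"
    and s_bound: "\<And>k i. AE \<omega> in M. s k \<omega> $ i \<le> S"
    and mean_s: "\<And>i. (\<integral>\<omega>. real (s 1 \<omega> $ i) \<partial>M) = \<mu> $ i"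
    and c: "c \<in> {0, 1}"
    and eta_pos: "0 < \<eta>"
    and level_drift: "\<And>U. (real (card U choose d) / real (CARD('n) choose d)) * (\<integral>\<omega>. real (a 1 \<omega>) \<partial>M) -
        (\<Sum>i\<in>U. \<mu> $ i) -
        c * real (card U) / real CARD('n) * ((\<integral>\<omega>. real (a 1 \<omega>) \<partial>M) - (\<Sum>i\<in>UNIV. \<mu> $ i))
        \<le> - \<eta> * norm (collapse c (ind_vec U))"
    and L_eq: "L = real CARD('n) * (real A + real S) + \<eta>"
    and K_eq: "K = 2 * real CARD('n) * (real S)\<^sup>2 + L\<^sup>2"
    and theta_eq: "\<theta> = \<eta> / (4 * L\<^sup>2)"
begin

section \<open>Drift of the Lyapunov function \<open>W\<close> in one slot\<close>

definition W :: "nat ^ 'n \<Rightarrow> real" where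
  "W x = norm (collapse c (real_vec x))"

lemma L_pos: "0 < L" and eta_le_L: "\<eta> \<le> L"
  using eta_pos by (simp_all add: L_eq add_nonneg_pos)

lemma K_pos: "0 < K"
  using L_pos by (simp add: K_eq add_nonneg_pos)

lemma theta_pos: "0 < \<theta>"
  using eta_pos L_pos by (simp add: theta_eq)

text \<open>The choice of \<open>\<theta>\<close> makes the second-order term of \<open>exp\<close>
  over one slot, at most \<open>(\<theta> * L)\<^sup>2\<close>, a quarter of the first-order gain
  \<open>\<theta> * \<eta>\<close>. The other bounds keep the exponent in the range of
  \<open>exp_le_quadratic\<close> and the factor \<open>1 - \<theta> * \<eta> / 2\<close>
  nonnegative.\<close>

lemma theta_L: "\<theta> * L \<le> 1" and theta_L_square: "(\<theta> * L)\<^sup>2 = \<theta> * \<eta> / 4" and theta_eta: "\<theta> * \<eta> \<le> 1"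
proof -
  show "(\<theta> * L)\<^sup>2 = \<theta> * \<eta> / 4"
    using L_pos by (simp add: theta_eq power2_eq_square)
  show *: "\<theta> * L \<le> 1"
    using L_pos eta_le_L by (simp add: theta_eq power2_eq_square field_simps)
  show "\<theta> * \<eta> \<le> 1"
    using mult_left_mono[OF eta_le_L less_imp_le[OF theta_pos]] * by linarith
qed

lemma step_decomposition:
  assumes \<omega>: "\<omega> \<in> space M" and s: "\<And>i. s k \<omega> $ i \<le> S"
  obtains av u where
    "real_vec (q (Suc k) \<omega>) = real_vec (q k \<omega>) + (av - real_vec (s k \<omega>) + u)"
    "av = (\<chi> i. if i = r k \<omega> then real (a k \<omega>) else 0)"
    "\<And>i. 0 \<le> u $ i" "\<And>i. u $ i \<le> real (s k \<omega> $ i)"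
    "\<And>i. real (q k \<omega> $ i) * u $ i \<le> (real S)\<^sup>2"
proof
  define av where "av = (\<chi> i. if i = r k \<omega> then real (a k \<omega>) else 0)"
  define u where "u = (\<chi> i. real_of_int (unused a s r q k \<omega> i))"
  show "real_vec (q (Suc k) \<omega>) = real_vec (q k \<omega>) + (av - real_vec (s k \<omega>) + u)"
  proof (subst vec_eq_iff, rule allI)
    fix i
    have "real_of_int (int (q (Suc k) \<omega> $ i)) = real_of_int (int (q k \<omega> $ i) +
        int (routed a r k \<omega> i) - int (s k \<omega> $ i) + unused a s r q k \<omega> i)"
      by (rule arg_cong[OF queue_dynamics[OF \<omega>]])
    then show "real_vec (q (Suc k) \<omega>) $ i =
        (real_vec (q k \<omega>) + (av - real_vec (s k \<omega>) + u)) $ i"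
      by (simp add: real_vec_def av_def u_def routed_def)
  qed
  show "av = (\<chi> i. if i = r k \<omega> then real (a k \<omega>) else 0)" by (simp add: av_def)
  show "0 \<le> u $ i" for i by (simp add: u_def unused_def)
  show le: "u $ i \<le> real (s k \<omega> $ i)" for i
    by (simp add: u_def unused_def)
  show "real (q k \<omega> $ i) * u $ i \<le> (real S)\<^sup>2" for i
  proof (cases "u $ i = 0")
    case False
    then have "real (q k \<omega> $ i) \<le> real S"
      using s[of i] by (simp add: u_def unused_def max_def split: if_splits)
    moreover have "u $ i \<le> real S"
      using le[of i] s[of i] by linarith
    moreover have "0 \<le> u $ i" by (simp add: u_def unused_def)
    ultimately show ?thesis by (simp add: power2_eq_square mult_mono)
  qed simp
qed

lemma W_step:
  assumes \<omega>: "\<omega> \<in> space M" and a: "a k \<omega> \<le> A" and s: "\<And>i. s k \<omega> $ i \<le> S"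
  shows "\<bar>W (q (Suc k) \<omega>) - W (q k \<omega>)\<bar> \<le> L"
    and "(W (q (Suc k) \<omega>))\<^sup>2 \<le> (W (q k \<omega>))\<^sup>2 +
      2 * (collapse c (real_vec (q k \<omega>)) \<bullet>
        ((\<chi> i. if i = r k \<omega> then real (a k \<omega>) else 0) - real_vec (s k \<omega>))) + K"
proof -
  obtain av u where step: "real_vec (q (Suc k) \<omega>) = real_vec (q k \<omega>) + (av - real_vec (s k \<omega>) + u)"
    and av: "av = (\<chi> i. if i = r k \<omega> then real (a k \<omega>) else 0)"
    and u: "\<And>i. 0 \<le> u $ i" "\<And>i. u $ i \<le> real (s k \<omega> $ i)"
      "\<And>i. real (q k \<omega> $ i) * u $ i \<le> (real S)\<^sup>2"
    using step_decomposition[OF \<omega> s] by blast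
  define x where "x = real_vec (q k \<omega>)"
  define z where "z = av - real_vec (s k \<omega>) + u"
  have "\<bar>z $ i\<bar> \<le> real A + real S" for i
    using u(1)[of i] u(2)[of i] s[of i] a by (auto simp: z_def av real_vec_def)
  then have "norm z \<le> real CARD('n) * (real A + real S)" by (rule norm_vec_le)
  then have "norm z \<le> L" using eta_pos by (simp add: L_eq)
  then have Tz: "norm (collapse c z) \<le> L" using norm_collapse_le[OF c, of z] by simp
  have Tx': "collapse c (real_vec (q (Suc k) \<omega>)) = collapse c x + collapse c z"
    unfolding step x_def z_def by (rule linear_add[OF linear_collapse])
  show "\<bar>W (q (Suc k) \<omega>) - W (q k \<omega>)\<bar> \<le> L"
    using norm_triangle_ineq3[of "collapse c x + collapse c z" "collapse c x"] Tz
    by (simp add: W_def Tx' flip: x_def)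
  \<comment> \<open>The averaging term that \<open>collapse\<close> subtracts is nonnegative, since
    \<open>x\<close> and \<open>u\<close> are.\<close>
  have "collapse c x \<bullet> u \<le> x \<bullet> u"
    using c u(1) by (auto simp: inner_collapse entry_sum_def x_def real_vec_def sum_nonneg)
  also have "x \<bullet> u = (\<Sum>i\<in>UNIV. real (q k \<omega> $ i) * u $ i)"
    by (simp add: inner_vec_def x_def real_vec_def)
  also have "\<dots> \<le> (\<Sum>i\<in>(UNIV :: 'n set). (real S)\<^sup>2)" by (intro sum_mono u)
  finally have xu: "collapse c x \<bullet> u \<le> real CARD('n) * (real S)\<^sup>2" by simp
  have "(W (q (Suc k) \<omega>))\<^sup>2 = (W (q k \<omega>))\<^sup>2 + 2 * (collapse c x \<bullet> collapse c z) + (norm (collapse c z))\<^sup>2"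
    by (simp add: W_def Tx' power2_norm_eq_inner inner_add_left inner_add_right inner_commute
        flip: x_def)
  also have "collapse c x \<bullet> collapse c z = collapse c x \<bullet> (av - real_vec (s k \<omega>)) + collapse c x \<bullet> u"
    by (simp add: collapse_inner_collapse[OF c] z_def inner_add_right)
  finally show "(W (q (Suc k) \<omega>))\<^sup>2 \<le> (W (q k \<omega>))\<^sup>2 +
      2 * (collapse c (real_vec (q k \<omega>)) \<bullet>
        ((\<chi> i. if i = r k \<omega> then real (a k \<omega>) else 0) - real_vec (s k \<omega>))) + K"
    using xu power_mono[OF Tz, of 2] by (simp add: K_eq av x_def)
qed

text \<open>This is the inner product of the projected indicator of the level set
  \<open>{i. t < x $ i}\<close> with arrivals minus potential service. Its mean given a history
  ending in \<open>x\<close> is the left side of \<open>level_drift\<close>.\<close>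

definition level_increment :: "nat ^ 'n \<Rightarrow> nat \<Rightarrow> nat \<Rightarrow> 'w \<Rightarrow> real" where
  "level_increment x t k \<omega> = real (if t < x $ (r k \<omega>) then a k \<omega> else 0) -
     (\<Sum>i | t < x $ i. real (s k \<omega> $ i)) -
     c * real (card {i. t < x $ i}) / real CARD('n) * (real (a k \<omega>) - (\<Sum>i\<in>UNIV. real (s k \<omega> $ i)))"

lemma collapse_inner_layers:
  assumes "\<And>i. x $ i \<le> n"
  shows "collapse c (real_vec x) \<bullet>
      ((\<chi> i. if i = r k \<omega> then real (a k \<omega>) else 0) - real_vec (s k \<omega>)) =
    (\<Sum>t<n. level_increment x t k \<omega>)"
proof -
  let ?v = "(\<chi> i. if i = r k \<omega> then real (a k \<omega>) else 0) - real_vec (s k \<omega>)"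
  have "collapse c (real_vec x) \<bullet> ?v = (\<Sum>t<n. collapse c (ind_vec {i. t < x $ i}) \<bullet> ?v)"
    unfolding real_vec_layer_cake[OF assms]
    by (simp add: linear_sum[OF linear_collapse] inner_sum_left)
  also have "\<dots> = (\<Sum>t<n. level_increment x t k \<omega>)"
    unfolding inner_collapse inner_ind_vec entry_sum_ind_vec
    by (intro sum.cong refl)
       (simp add: level_increment_def entry_sum_def real_vec_def sum_subtractf)
  finally show ?thesis .
qed

text \<open>The level set is constant on one history, so the routed arrivals, the total arrivals and
  each service have explicit means there. They combine to the expression that
  \<open>level_drift\<close> bounds.\<close>

lemma integral_level_increment:
  fixes h k
  defines "p \<equiv> prob {\<omega>\<in>space M. queue_history q k \<omega> = h}"
  shows "integrable M (\<lambda>\<omega>. indicator {\<omega>\<in>space M. queue_history q k \<omega> = h} \<omega> *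
      level_increment (last h) t k \<omega>)"
    and "(\<integral>\<omega>. indicator {\<omega>\<in>space M. queue_history q k \<omega> = h} \<omega> *
      level_increment (last h) t k \<omega> \<partial>M) \<le>
      p * (- \<eta> * norm (collapse c (ind_vec {i. t < last h $ i})))"
proof -
  define H where "H = {\<omega>\<in>space M. queue_history q k \<omega> = h}"
  define U where "U = {i. t < last h $ i}"
  define rate where "rate = (\<integral>\<omega>. real (a 1 \<omega>) \<partial>M)"
  define \<beta> where "\<beta> = real (card U choose d) / real (CARD('n) choose d)"
  define \<gamma> where "\<gamma> = c * real (card U) / real CARD('n)"
  have [measurable]: "H \<in> events" unfolding H_def by measurable
  have routed: "has_bochner_integral M
      (\<lambda>\<omega>. indicator H \<omega> * real (if t < last h $ (r k \<omega>) then a k \<omega> else 0)) (p * \<beta> * rate)"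
    unfolding has_bochner_integral_iff
  proof
    show "integrable M (\<lambda>\<omega>. indicator H \<omega> * real (if t < last h $ (r k \<omega>) then a k \<omega> else 0))"
    proof (rule integrable_indicator_bounded_nat)
      show "AE \<omega> in M. (if t < last h $ (r k \<omega>) then a k \<omega> else 0) \<le> A"
        using a_bound[of k] by eventually_elim simp
    qed measurable
    show "(\<integral>\<omega>. indicator H \<omega> * real (if t < last h $ (r k \<omega>) then a k \<omega> else 0) \<partial>M) = p * \<beta> * rate"
      using integral_routed_arrivals[OF a_bound, of k h t]
      by (simp add: H_def p_def \<beta>_def rate_def U_def)
  qed
  have arr: "has_bochner_integral M (\<lambda>\<omega>. indicator H \<omega> * real (a k \<omega>)) (p * rate)"
    unfolding has_bochner_integral_iff H_def p_def rate_def
    using integral_arrivals[OF a_bound] integrable_indicator_bounded_nat[OF _ _ a_bound]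
    by simp
  have serv: "has_bochner_integral M (\<lambda>\<omega>. indicator H \<omega> * real (s k \<omega> $ i)) (p * \<mu> $ i)" for i
    unfolding has_bochner_integral_iff H_def p_def mean_s[symmetric]
    using integral_services[OF s_bound] integrable_indicator_bounded_nat[OF _ _ s_bound]
    by simp
  have "has_bochner_integral M (\<lambda>\<omega>.
      indicator H \<omega> * real (if t < last h $ (r k \<omega>) then a k \<omega> else 0) -
      (\<Sum>i\<in>U. indicator H \<omega> * real (s k \<omega> $ i)) -
      \<gamma> * (indicator H \<omega> * real (a k \<omega>) - (\<Sum>i\<in>UNIV. indicator H \<omega> * real (s k \<omega> $ i))))
      (p * \<beta> * rate - (\<Sum>i\<in>U. p * \<mu> $ i) - \<gamma> * (p * rate - (\<Sum>i\<in>UNIV. p * \<mu> $ i)))"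
    by (intro has_bochner_integral_diff has_bochner_integral_sum has_bochner_integral_mult_right
        routed arr serv)
  also have "(\<lambda>\<omega>. indicator H \<omega> * real (if t < last h $ (r k \<omega>) then a k \<omega> else 0) -
      (\<Sum>i\<in>U. indicator H \<omega> * real (s k \<omega> $ i)) -
      \<gamma> * (indicator H \<omega> * real (a k \<omega>) - (\<Sum>i\<in>UNIV. indicator H \<omega> * real (s k \<omega> $ i)))) =
      (\<lambda>\<omega>. indicator H \<omega> * level_increment (last h) t k \<omega>)"
    by (simp add: fun_eq_iff level_increment_def U_def \<gamma>_def indicator_def)
  also have "p * \<beta> * rate - (\<Sum>i\<in>U. p * \<mu> $ i) - \<gamma> * (p * rate - (\<Sum>i\<in>UNIV. p * \<mu> $ i)) =
      p * (\<beta> * rate - (\<Sum>i\<in>U. \<mu> $ i) - \<gamma> * (rate - (\<Sum>i\<in>UNIV. \<mu> $ i)))"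
    by (simp add: algebra_simps sum_distrib_left)
  finally have hb: "has_bochner_integral M (\<lambda>\<omega>. indicator H \<omega> * level_increment (last h) t k \<omega>)
      (p * (\<beta> * rate - (\<Sum>i\<in>U. \<mu> $ i) - \<gamma> * (rate - (\<Sum>i\<in>UNIV. \<mu> $ i))))" .
  show "integrable M (\<lambda>\<omega>. indicator {\<omega>\<in>space M. queue_history q k \<omega> = h} \<omega> *
      level_increment (last h) t k \<omega>)"
    using hb unfolding H_def by (rule integrable.intros)
  have "p * (\<beta> * rate - (\<Sum>i\<in>U. \<mu> $ i) - \<gamma> * (rate - (\<Sum>i\<in>UNIV. \<mu> $ i))) \<le>
      p * (- \<eta> * norm (collapse c (ind_vec U)))"
    using level_drift[of U] unfolding \<beta>_def \<gamma>_def rate_def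
    by (intro mult_left_mono) (simp_all add: p_def)
  then show "(\<integral>\<omega>. indicator {\<omega>\<in>space M. queue_history q k \<omega> = h} \<omega> *
      level_increment (last h) t k \<omega> \<partial>M) \<le>
      p * (- \<eta> * norm (collapse c (ind_vec {i. t < last h $ i})))"
    using has_bochner_integral_integral_eq[OF hb] by (simp add: H_def U_def)
qed

text \<open>By the triangle inequality the norms of the projected layers add up to at least
  \<open>W\<close>, so drifts proportional to these norms sum to a drift proportional to
  \<open>W\<close>.\<close>

lemma integral_sum_level_increment:
  fixes h k
  defines "p \<equiv> prob {\<omega>\<in>space M. queue_history q k \<omega> = h}"
  assumes "\<And>i. last h $ i \<le> n"
  shows "integrable M (\<lambda>\<omega>. indicator {\<omega>\<in>space M. queue_history q k \<omega> = h} \<omega> *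
      (\<Sum>t<n. level_increment (last h) t k \<omega>))"
    and "(\<integral>\<omega>. indicator {\<omega>\<in>space M. queue_history q k \<omega> = h} \<omega> *
      (\<Sum>t<n. level_increment (last h) t k \<omega>) \<partial>M) \<le> p * (- \<eta> * W (last h))"
proof -
  show "integrable M (\<lambda>\<omega>. indicator {\<omega>\<in>space M. queue_history q k \<omega> = h} \<omega> *
      (\<Sum>t<n. level_increment (last h) t k \<omega>))"
    unfolding sum_distrib_left by (intro Bochner_Integration.integrable_sum integral_level_increment)
  have "(\<integral>\<omega>. indicator {\<omega>\<in>space M. queue_history q k \<omega> = h} \<omega> *
      (\<Sum>t<n. level_increment (last h) t k \<omega>) \<partial>M) \<le>
      (\<Sum>t<n. p * (- \<eta> * norm (collapse c (ind_vec {i. t < last h $ i}))))"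
    unfolding sum_distrib_left p_def
    by (subst Bochner_Integration.integral_sum) (intro integral_level_increment sum_mono)+
  also have "\<dots> = p * (- \<eta> * (\<Sum>t<n. norm (collapse c (ind_vec {i. t < last h $ i}))))"
    by (simp add: sum_distrib_left sum_negf)
  also have "\<dots> \<le> p * (- \<eta> * W (last h))"
  proof (rule mult_left_mono)
    have "W (last h) \<le> (\<Sum>t<n. norm (collapse c (ind_vec {i. t < last h $ i})))"
      unfolding W_def real_vec_layer_cake[OF assms(2)] linear_sum[OF linear_collapse]
      by (rule norm_sum)
    then show "- \<eta> * (\<Sum>t<n. norm (collapse c (ind_vec {i. t < last h $ i}))) \<le> - \<eta> * W (last h)"
      using eta_pos by simp
  qed (simp add: p_def)
  finally show "(\<integral>\<omega>. indicator {\<omega>\<in>space M. queue_history q k \<omega> = h} \<omega> *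
      (\<Sum>t<n. level_increment (last h) t k \<omega>) \<partial>M) \<le> p * (- \<eta> * W (last h))" .
qed

section \<open>Contraction of the exponential moment\<close>

definition growth :: real where
  "growth = exp (\<theta> * (2 * K / \<eta> + L))"

text \<open>Dividing the drift of the square by \<open>2 * W\<close> gives a drift of
  \<open>W\<close> itself. Far out, the error \<open>K / (2 * W)\<close> is at most
  \<open>\<eta> / 4\<close>; together with the quadratic term of \<open>exp\<close> this costs
  \<open>\<theta> * \<eta> / 2\<close>.\<close>

lemma exp_W_step_far:
  assumes \<omega>: "\<omega> \<in> space M" and a: "a k \<omega> \<le> A" and s: "\<And>i. s k \<omega> $ i \<le> S"
    and far: "2 * K / \<eta> \<le> W (q k \<omega>)" and n: "\<And>i. q k \<omega> $ i \<le> n"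
  shows "exp (\<theta> * W (q (Suc k) \<omega>)) \<le> exp (\<theta> * W (q k \<omega>)) *
    (1 + \<theta> * \<eta> / 2 + \<theta> / W (q k \<omega>) * (\<Sum>t<n. level_increment (q k \<omega>) t k \<omega>))"
proof -
  define w w' Z where "w = W (q k \<omega>)" and "w' = W (q (Suc k) \<omega>)"
    and "Z = (\<Sum>t<n. level_increment (q k \<omega>) t k \<omega>)"
  have w: "0 < w" using far K_pos eta_pos unfolding w_def by (smt (verit) divide_pos_pos)
  have jump: "\<bar>w' - w\<bar> \<le> L" and square: "w'\<^sup>2 \<le> w\<^sup>2 + 2 * Z + K"
    using W_step[OF \<omega> a s] unfolding w_def w'_def Z_def collapse_inner_layers[OF n] by simp_all
  have "\<bar>\<theta> * (w' - w)\<bar> \<le> \<theta> * L"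
    using jump theta_pos by (simp add: abs_mult)
  then have small: "\<bar>\<theta> * (w' - w)\<bar> \<le> 1" and "(\<theta> * (w' - w))\<^sup>2 \<le> (\<theta> * L)\<^sup>2"
    using theta_L power_mono[of "\<bar>\<theta> * (w' - w)\<bar>" "\<theta> * L" 2] by auto
  \<comment> \<open>This is \<open>(w' - w)\<^sup>2 \<ge> 0\<close> rearranged.\<close>
  have "2 * w * (w' - w) \<le> w'\<^sup>2 - w\<^sup>2"
    using zero_le_power2[of "w' - w"] by (simp add: power2_eq_square algebra_simps)
  also have "\<dots> \<le> 2 * Z + K" using square by simp
  finally have "w' - w \<le> Z / w + K / (2 * w)"
    using w by (simp add: field_simps)
  moreover have "K / (2 * w) \<le> \<eta> / 4"
    using far w eta_pos unfolding w_def[symmetric] by (simp add: field_simps)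
  ultimately have "\<theta> * (w' - w) \<le> \<theta> * (Z / w + \<eta> / 4)"
    using theta_pos by (intro mult_left_mono) auto
  then have "1 + \<theta> * (w' - w) + (\<theta> * (w' - w))\<^sup>2 \<le> 1 + \<theta> * \<eta> / 2 + \<theta> / w * Z"
    using \<open>(\<theta> * (w' - w))\<^sup>2 \<le> (\<theta> * L)\<^sup>2\<close> theta_L_square by (simp add: algebra_simps)
  then have "exp (\<theta> * (w' - w)) \<le> 1 + \<theta> * \<eta> / 2 + \<theta> / w * Z"
    using exp_le_quadratic[OF small] by linarith
  then have "exp (\<theta> * w) * exp (\<theta> * (w' - w)) \<le> exp (\<theta> * w) * (1 + \<theta> * \<eta> / 2 + \<theta> / w * Z)"
    by (rule mult_left_mono) simp
  then show ?thesis
    unfolding w_def w'_def Z_def by (simp add: exp_add[symmetric] algebra_simps)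
qed

text \<open>For \<open>W\<close> below \<open>2 * K / \<eta>\<close> a jump of at most
  \<open>L\<close> keeps the exponential below \<open>growth\<close>. Otherwise the mean drift
  outweighs the cost in \<open>exp_W_step_far\<close>.\<close>

lemma integral_exp_W_step:
  fixes h k
  defines "H \<equiv> {\<omega>\<in>space M. queue_history q k \<omega> = h}"
  shows "integrable M (\<lambda>\<omega>. indicator H \<omega> * exp (\<theta> * W (q (Suc k) \<omega>)))"
    and "(\<integral>\<omega>. indicator H \<omega> * exp (\<theta> * W (q (Suc k) \<omega>)) \<partial>M) \<le>
      prob H * ((1 - \<theta> * \<eta> / 2) * exp (\<theta> * W (last h)) + growth)"
proof -
  define w where "w = W (last h)"
  have [measurable]: "H \<in> events" unfolding H_def by measurable
  have last_h: "q k \<omega> = last h" if "\<omega> \<in> H" for \<omega>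
    using that by (auto simp: H_def queue_history_def)
  have in_space: "\<omega> \<in> space M" if "\<omega> \<in> H" for \<omega>
    using that by (simp add: H_def)
  have s_all: "AE \<omega> in M. \<forall>i. s k \<omega> $ i \<le> S"
    using s_bound by (simp add: AE_all_countable)
  have bound: "AE \<omega> in M. indicator H \<omega> * exp (\<theta> * W (q (Suc k) \<omega>)) \<le> indicator H \<omega> * exp (\<theta> * (w + L))"
    using a_bound[of k] s_all
  proof eventually_elim
    case (elim \<omega>)
    show ?case
    proof (cases "\<omega> \<in> H")
      case True
      have "W (q (Suc k) \<omega>) \<le> w + L"
        using W_step(1)[OF in_space[OF True], of k] elim by (simp add: w_def last_h[OF True] abs_le_iff)
      then show ?thesis using True theta_pos by simp
    qed simp
  qed
  show int: "integrable M (\<lambda>\<omega>. indicator H \<omega> * exp (\<theta> * W (q (Suc k) \<omega>)))"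
  proof (rule integrable_const_bound)
    show "AE \<omega> in M. norm (indicator H \<omega> * exp (\<theta> * W (q (Suc k) \<omega>))) \<le> exp (\<theta> * (w + L))"
      using bound by eventually_elim (auto simp: indicator_def)
  qed measurable
  have ind_integrable: "integrable M (indicat_real H)"
    by (intro integrable_real_indicator) (auto simp: less_top[symmetric])
  then have H_integrable: "integrable M (\<lambda>\<omega>. indicator H \<omega> * b)" for b :: real
    by simp
  show "(\<integral>\<omega>. indicator H \<omega> * exp (\<theta> * W (q (Suc k) \<omega>)) \<partial>M) \<le>
      prob H * ((1 - \<theta> * \<eta> / 2) * exp (\<theta> * W (last h)) + growth)"
  proof (cases "2 * K / \<eta> \<le> w")
    case False
    have "(\<integral>\<omega>. indicator H \<omega> * exp (\<theta> * W (q (Suc k) \<omega>)) \<partial>M) \<le>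
        (\<integral>\<omega>. indicator H \<omega> * exp (\<theta> * (w + L)) \<partial>M)"
      using bound by (intro integral_mono_AE int H_integrable)
    also have "\<dots> = prob H * exp (\<theta> * (w + L))" by simp
    also have "\<dots> \<le> prob H * ((1 - \<theta> * \<eta> / 2) * exp (\<theta> * W (last h)) + growth)"
    proof (rule mult_left_mono)
      have "exp (\<theta> * (w + L)) \<le> growth"
        using False theta_pos by (simp add: growth_def)
      moreover have "0 \<le> (1 - \<theta> * \<eta> / 2) * exp (\<theta> * W (last h))"
        using theta_eta by simp
      ultimately show "exp (\<theta> * (w + L)) \<le> (1 - \<theta> * \<eta> / 2) * exp (\<theta> * W (last h)) + growth"
        by simp
    qed simp
    finally show ?thesis .
  next
    case True
    obtain n where n: "\<And>i. last h $ i \<le> n"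
      using finite_nat_set_iff_bounded_le[of "range (\<lambda>i. last h $ i)"] by auto
    have w: "0 < w" using True K_pos eta_pos by (smt (verit) divide_pos_pos)
    define Z where "Z \<omega> = (\<Sum>t<n. level_increment (last h) t k \<omega>)" for \<omega>
    note Z = integral_sum_level_increment[OF n, where k = k, folded H_def Z_def w_def]
    have "(\<integral>\<omega>. indicator H \<omega> * exp (\<theta> * W (q (Suc k) \<omega>)) \<partial>M) \<le>
        (\<integral>\<omega>. indicator H \<omega> * (exp (\<theta> * w) * (1 + \<theta> * \<eta> / 2)) +
          exp (\<theta> * w) * (\<theta> / w) * (indicator H \<omega> * Z \<omega>) \<partial>M)"
    proof (rule integral_mono_AE)
      show "AE \<omega> in M. indicator H \<omega> * exp (\<theta> * W (q (Suc k) \<omega>)) \<le>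
          indicator H \<omega> * (exp (\<theta> * w) * (1 + \<theta> * \<eta> / 2)) +
          exp (\<theta> * w) * (\<theta> / w) * (indicator H \<omega> * Z \<omega>)"
        using a_bound[of k] s_all
      proof eventually_elim
        case (elim \<omega>)
        show ?case
        proof (cases "\<omega> \<in> H")
          case \<omega>: True
          then show ?thesis
            using exp_W_step_far[OF in_space[OF \<omega>], of k n] elim True n
            by (simp add: last_h[OF \<omega>] Z_def w_def[symmetric] algebra_simps)
        qed simp
      qed
    qed (intro int H_integrable Bochner_Integration.integrable_add integrable_mult_right Z(1))+
    also have "\<dots> = prob H * (exp (\<theta> * w) * (1 + \<theta> * \<eta> / 2)) +
        exp (\<theta> * w) * (\<theta> / w) * (\<integral>\<omega>. indicator H \<omega> * Z \<omega> \<partial>M)"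
      by (subst Bochner_Integration.integral_add)
         (simp_all add: H_integrable ind_integrable integrable_mult_right Z(1))
    \<comment> \<open>The mean of \<open>Z\<close> contributes \<open>- \<theta> * \<eta>\<close> to
      the factor, which turns \<open>1 + \<theta> * \<eta> / 2\<close> into
      \<open>1 - \<theta> * \<eta> / 2\<close>.\<close>
    also have "\<dots> \<le> prob H * (exp (\<theta> * w) * (1 + \<theta> * \<eta> / 2)) +
        exp (\<theta> * w) * (\<theta> / w) * (prob H * (- \<eta> * w))"
      using w theta_pos by (intro add_left_mono mult_left_mono Z(2)) simp
    also have "\<dots> = prob H * ((1 - \<theta> * \<eta> / 2) * exp (\<theta> * w))"
      using w by (simp add: field_simps)
    also have "\<dots> \<le> prob H * ((1 - \<theta> * \<eta> / 2) * exp (\<theta> * W (last h)) + growth)"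
      by (intro mult_left_mono) (simp_all add: w_def growth_def)
    finally show ?thesis .
  qed
qed

text \<open>The one-history estimates are summed over all histories. The event on \<open>q 0\<close>
  depends only on the first entry of the history, so each atom lies inside it or outside it.\<close>

lemma nn_integral_exp_W_step:
  "(\<integral>\<^sup>+\<omega>. ennreal (exp (\<theta> * W (q (Suc k) \<omega>))) * indicator {\<omega>\<in>space M. q 0 \<omega> \<in> F} \<omega> \<partial>M) \<le>
    ennreal (1 - \<theta> * \<eta> / 2) *
      (\<integral>\<^sup>+\<omega>. ennreal (exp (\<theta> * W (q k \<omega>))) * indicator {\<omega>\<in>space M. q 0 \<omega> \<in> F} \<omega> \<partial>M) +
    ennreal growth"
proof -
  define \<rho> where "\<rho> = 1 - \<theta> * \<eta> / 2"
  have \<rho>: "0 \<le> \<rho>" using theta_eta by (simp add: \<rho>_def)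
  have growth: "0 \<le> growth" by (simp add: growth_def)
  define G where "G = {\<omega>\<in>space M. q 0 \<omega> \<in> F}"
  have [measurable]: "G \<in> events" unfolding G_def by measurable
  have "(\<integral>\<^sup>+\<omega>. ennreal (exp (\<theta> * W (q (Suc k) \<omega>))) * indicator G \<omega> \<partial>M) \<le>
      (\<integral>\<^sup>+\<omega>. (ennreal \<rho> * ennreal (exp (\<theta> * W (q k \<omega>))) + ennreal growth) * indicator G \<omega> \<partial>M)"
  proof (rule nn_integral_mono_discrete[of "queue_history q k"])
    fix h
    define H where "H = {\<omega>\<in>space M. queue_history q k \<omega> = h}"
    have [measurable]: "H \<in> events" unfolding H_def by measurable
    have hist: "q k \<omega> = last h" "q 0 \<omega> = hd h" if "\<omega> \<in> H" for \<omega>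
      using that by (auto simp: H_def queue_history_def hd_map simp del: upt_Suc)
         (simp add: queue_history_def)
    have "(\<integral>\<^sup>+\<omega>. ennreal (exp (\<theta> * W (q (Suc k) \<omega>))) * indicator H \<omega> \<partial>M) =
        (\<integral>\<^sup>+\<omega>. ennreal (indicator H \<omega> * exp (\<theta> * W (q (Suc k) \<omega>))) \<partial>M)"
      by (intro nn_integral_cong) (simp add: indicator_def)
    also have "\<dots> = ennreal (\<integral>\<omega>. indicator H \<omega> * exp (\<theta> * W (q (Suc k) \<omega>)) \<partial>M)"
      unfolding H_def by (intro nn_integral_eq_integral integral_exp_W_step) simp
    also have "\<dots> \<le> ennreal (prob H * (\<rho> * exp (\<theta> * W (last h)) + growth))"
      unfolding H_def \<rho>_def by (intro ennreal_leI integral_exp_W_step)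
    also have "\<dots> = (\<integral>\<^sup>+\<omega>. ennreal (\<rho> * exp (\<theta> * W (last h)) + growth) * indicator H \<omega> \<partial>M)"
      by (subst nn_integral_cmult_indicator)
         (simp_all add: emeasure_eq_measure ennreal_mult'[symmetric] mult.commute)
    also have "\<dots> = (\<integral>\<^sup>+\<omega>. (ennreal \<rho> * ennreal (exp (\<theta> * W (q k \<omega>))) + ennreal growth) * indicator H \<omega> \<partial>M)"
      using \<rho> growth
      by (intro nn_integral_cong) (auto simp: indicator_def hist ennreal_mult' ennreal_plus)
    finally have le: "(\<integral>\<^sup>+\<omega>. ennreal (exp (\<theta> * W (q (Suc k) \<omega>))) * indicator H \<omega> \<partial>M) \<le>
      (\<integral>\<^sup>+\<omega>. (ennreal \<rho> * ennreal (exp (\<theta> * W (q k \<omega>))) + ennreal growth) * indicator H \<omega> \<partial>M)" .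
    have restrict: "(\<integral>\<^sup>+\<omega>. g \<omega> * indicator G \<omega> * indicator H \<omega> \<partial>M) =
        (if hd h \<in> F then (\<integral>\<^sup>+\<omega>. g \<omega> * indicator H \<omega> \<partial>M) else 0)" for g :: "'w \<Rightarrow> ennreal"
    proof -
      have "(\<integral>\<^sup>+\<omega>. g \<omega> * indicator G \<omega> * indicator H \<omega> \<partial>M) =
          (\<integral>\<^sup>+\<omega>. (if hd h \<in> F then g \<omega> * indicator H \<omega> else 0) \<partial>M)"
        by (intro nn_integral_cong) (auto simp: indicator_def G_def hist)
      then show ?thesis by (simp split: if_splits)
    qed
    show "(\<integral>\<^sup>+\<omega>. ennreal (exp (\<theta> * W (q (Suc k) \<omega>))) * indicator G \<omega> *
          indicator {\<omega>\<in>space M. queue_history q k \<omega> = h} \<omega> \<partial>M) \<le>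
        (\<integral>\<^sup>+\<omega>. (ennreal \<rho> * ennreal (exp (\<theta> * W (q k \<omega>))) + ennreal growth) * indicator G \<omega> *
          indicator {\<omega>\<in>space M. queue_history q k \<omega> = h} \<omega> \<partial>M)"
      unfolding H_def[symmetric] restrict using le by simp
  qed measurable
  also have "\<dots> = (\<integral>\<^sup>+\<omega>. ennreal \<rho> * (ennreal (exp (\<theta> * W (q k \<omega>))) * indicator G \<omega>) +
      ennreal growth * indicator G \<omega> \<partial>M)"
    by (intro nn_integral_cong) (simp add: indicator_def)
  also have "\<dots> = ennreal \<rho> * (\<integral>\<^sup>+\<omega>. ennreal (exp (\<theta> * W (q k \<omega>))) * indicator G \<omega> \<partial>M) +
      ennreal growth * emeasure M G"
    by (simp add: nn_integral_add nn_integral_cmult)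
  also have "\<dots> \<le> ennreal \<rho> * (\<integral>\<^sup>+\<omega>. ennreal (exp (\<theta> * W (q k \<omega>))) * indicator G \<omega> \<partial>M) +
      ennreal growth * 1"
    by (intro add_left_mono mult_left_mono) (simp_all add: emeasure_eq_measure)
  finally show ?thesis by (simp add: \<rho>_def G_def)
qed

text \<open>The fixed point of the affine recursion in
  \<open>nn_integral_exp_W_step\<close>.\<close>

definition exp_moment_bound :: real where
  "exp_moment_bound = 2 * growth / (\<theta> * \<eta>)"

text \<open>Iterating the recursion, the influence of the start decays geometrically, while the
  remaining bound depends on neither \<open>F\<close> nor \<open>b\<close>.\<close>

lemma nn_integral_exp_W_bounded_start:
  assumes F: "\<And>x. x \<in> F \<Longrightarrow> W x \<le> b" and b: "0 \<le> b"
  shows "(\<integral>\<^sup>+\<omega>. ennreal (exp (\<theta> * W (q k \<omega>))) * indicator {\<omega>\<in>space M. q 0 \<omega> \<in> F} \<omega> \<partial>M) \<le>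
    ennreal ((1 - \<theta> * \<eta> / 2) ^ k * exp (\<theta> * b) + exp_moment_bound)"
proof (induction k)
  case 0
  have "(\<integral>\<^sup>+\<omega>. ennreal (exp (\<theta> * W (q 0 \<omega>))) * indicator {\<omega>\<in>space M. q 0 \<omega> \<in> F} \<omega> \<partial>M) \<le>
      (\<integral>\<^sup>+\<omega>. ennreal (exp (\<theta> * b)) \<partial>M)"
    using F theta_pos by (intro nn_integral_mono) (auto simp: indicator_def)
  also have "\<dots> = ennreal (exp (\<theta> * b))" by (simp add: emeasure_space_1)
  also have "\<dots> \<le> ennreal ((1 - \<theta> * \<eta> / 2) ^ 0 * exp (\<theta> * b) + exp_moment_bound)"
    using theta_pos eta_pos by (intro ennreal_leI) (simp add: exp_moment_bound_def growth_def)
  finally show ?case .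
next
  case (Suc k)
  define \<rho> where "\<rho> = 1 - \<theta> * \<eta> / 2"
  have \<rho>: "0 \<le> \<rho>" using theta_eta by (simp add: \<rho>_def)
  have fixpoint: "0 \<le> exp_moment_bound" "\<rho> * exp_moment_bound + growth = exp_moment_bound"
    using theta_pos eta_pos by (simp_all add: exp_moment_bound_def growth_def \<rho>_def field_simps)
  have "(\<integral>\<^sup>+\<omega>. ennreal (exp (\<theta> * W (q (Suc k) \<omega>))) * indicator {\<omega>\<in>space M. q 0 \<omega> \<in> F} \<omega> \<partial>M) \<le>
      ennreal \<rho> * (\<integral>\<^sup>+\<omega>. ennreal (exp (\<theta> * W (q k \<omega>))) * indicator {\<omega>\<in>space M. q 0 \<omega> \<in> F} \<omega> \<partial>M) +
      ennreal growth"
    unfolding \<rho>_def by (rule nn_integral_exp_W_step)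
  also have "\<dots> \<le> ennreal \<rho> * ennreal (\<rho> ^ k * exp (\<theta> * b) + exp_moment_bound) + ennreal growth"
    using Suc.IH unfolding \<rho>_def by (intro add_right_mono mult_left_mono) simp_all
  also have "\<dots> = ennreal (\<rho> * (\<rho> ^ k * exp (\<theta> * b) + exp_moment_bound) + growth)"
    using \<rho> fixpoint by (simp add: ennreal_mult ennreal_plus growth_def)
  also have "\<rho> * (\<rho> ^ k * exp (\<theta> * b) + exp_moment_bound) + growth =
      \<rho> ^ Suc k * exp (\<theta> * b) + exp_moment_bound"
    using fixpoint(2) by (simp add: algebra_simps)
  finally show ?case by (simp only: \<rho>_def)
qed

section \<open>Passage to the limit distribution\<close>

lemma prob_large_start: "(\<lambda>n. prob {\<omega>\<in>space M. real n < W (q 0 \<omega>)}) \<longlonglongrightarrow> 0"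
proof -
  have "(\<lambda>n. prob {\<omega>\<in>space M. real n < W (q 0 \<omega>)}) \<longlonglongrightarrow> prob (\<Inter>n. {\<omega>\<in>space M. real n < W (q 0 \<omega>)})"
    by (rule finite_Lim_measure_decseq) (auto simp: decseq_def)
  also have "(\<Inter>n. {\<omega>\<in>space M. real n < W (q 0 \<omega>)}) = {}"
  proof -
    have "\<exists>n. \<not> real n < W (q 0 \<omega>)" for \<omega>
      using real_arch_simple[of "W (q 0 \<omega>)"] by (auto simp: not_less)
    then show ?thesis by blast
  qed
  finally show ?thesis by simp
qed

text \<open>Truncation at \<open>b\<close> gives a bounded continuous function, as weak convergence
  requires. For a start with \<open>W\<close> at most \<open>n\<close>, the limit in
  \<open>k\<close> removes the geometric term; the limit in \<open>n\<close> then removes the larger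
  starts.\<close>

lemma limit_truncated_exp:
  fixes Q :: "'v \<Rightarrow> real ^ 'n"
  assumes conv: "converges_in_distribution M (\<lambda>k \<omega>. real_vec (q k \<omega>)) N Q"
    and b: "0 \<le> b"
  shows "(\<integral>\<omega>. min (exp (\<theta> * norm (collapse c (Q \<omega>)))) b \<partial>N) \<le> exp_moment_bound"
proof -
  define f where "f x = min (exp (\<theta> * norm (collapse c x))) b" for x :: "real ^ 'n"
  have f_bounds: "0 \<le> f x" "f x \<le> b" for x using b by (auto simp: f_def)
  have f_W: "f (real_vec x) = min (exp (\<theta> * W x)) b" for x by (simp add: f_def W_def)
  have "continuous_on UNIV f"
    unfolding f_def
    by (intro continuous_intros continuous_collapse)
  moreover have "bounded (range f)"
    using f_bounds by (intro boundedI[of _ b]) auto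
  ultimately have lim: "(\<lambda>k. \<integral>\<omega>. f (real_vec (q k \<omega>)) \<partial>M) \<longlonglongrightarrow> (\<integral>\<omega>. f (Q \<omega>) \<partial>N)"
    using conv unfolding converges_in_distribution_def by blast
  have le: "(\<integral>\<omega>. f (Q \<omega>) \<partial>N) \<le> exp_moment_bound + b * prob {\<omega>\<in>space M. real n < W (q 0 \<omega>)}" for n
  proof (rule LIMSEQ_le[OF lim])
    define F where "F = {x. W x \<le> real n}"
    define G where "G = {\<omega>\<in>space M. q 0 \<omega> \<in> F}"
    define \<rho> where "\<rho> = 1 - \<theta> * \<eta> / 2"
    have \<rho>: "0 \<le> \<rho>" "\<rho> < 1" using theta_eta theta_pos eta_pos by (simp_all add: \<rho>_def)
    have "0 \<le> exp_moment_bound"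
      using theta_pos eta_pos by (simp add: exp_moment_bound_def growth_def)
    have [measurable]: "G \<in> events" unfolding G_def by measurable
    show "(\<lambda>k. \<rho> ^ k * exp (\<theta> * real n) + exp_moment_bound + b * prob {\<omega>\<in>space M. real n < W (q 0 \<omega>)})
        \<longlonglongrightarrow> exp_moment_bound + b * prob {\<omega>\<in>space M. real n < W (q 0 \<omega>)}"
      using \<rho> by (auto intro!: tendsto_eq_intros LIMSEQ_power_zero)
    have compl: "prob (space M - G) = prob {\<omega>\<in>space M. real n < W (q 0 \<omega>)}"
      by (rule arg_cong[where f = prob]) (auto simp: G_def F_def)
    have f_int: "integrable M (\<lambda>\<omega>. f (real_vec (q k \<omega>)) * indicator B \<omega>)"
      if [measurable]: "B \<in> events" for k B
    proof (rule integrable_const_bound)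
      show "AE \<omega> in M. norm (f (real_vec (q k \<omega>)) * indicator B \<omega>) \<le> b"
        using f_bounds by (auto simp: indicator_def b)
    qed (unfold f_W, measurable)
    have "(\<integral>\<omega>. f (real_vec (q k \<omega>)) \<partial>M) \<le>
        \<rho> ^ k * exp (\<theta> * real n) + exp_moment_bound + b * prob {\<omega>\<in>space M. real n < W (q 0 \<omega>)}" for k
    proof -
      have "ennreal (\<integral>\<omega>. f (real_vec (q k \<omega>)) * indicator G \<omega> \<partial>M) =
          (\<integral>\<^sup>+\<omega>. ennreal (f (real_vec (q k \<omega>)) * indicator G \<omega>) \<partial>M)"
        using f_bounds by (intro nn_integral_eq_integral[symmetric] f_int) auto
      also have "\<dots> \<le> (\<integral>\<^sup>+\<omega>. ennreal (exp (\<theta> * W (q k \<omega>))) * indicator G \<omega> \<partial>M)"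
        by (intro nn_integral_mono) (auto simp: f_W indicator_def intro!: ennreal_leI)
      also have "\<dots> \<le> ennreal (\<rho> ^ k * exp (\<theta> * real n) + exp_moment_bound)"
        unfolding G_def \<rho>_def by (rule nn_integral_exp_W_bounded_start) (simp_all add: F_def)
      finally have "(\<integral>\<omega>. f (real_vec (q k \<omega>)) * indicator G \<omega> \<partial>M) \<le>
          \<rho> ^ k * exp (\<theta> * real n) + exp_moment_bound"
        using \<rho> \<open>0 \<le> exp_moment_bound\<close> by (subst (asm) ennreal_le_iff) auto
      \<comment> \<open>For large starts the truncation level \<open>b\<close> is the bound.\<close>
      moreover have "(\<integral>\<omega>. f (real_vec (q k \<omega>)) * indicator (space M - G) \<omega> \<partial>M) \<le>
          (\<integral>\<omega>. b * indicator (space M - G) \<omega> \<partial>M)"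
        using f_bounds by (intro integral_mono f_int integrable_mult_right integrable_real_indicator)
          (auto simp: indicator_def less_top[symmetric])
      moreover have "(\<integral>\<omega>. b * indicator (space M - G) \<omega> \<partial>M) = b * prob (space M - G)"
        by simp
      moreover have "(\<integral>\<omega>. f (real_vec (q k \<omega>)) \<partial>M) =
          (\<integral>\<omega>. f (real_vec (q k \<omega>)) * indicator G \<omega> \<partial>M) +
          (\<integral>\<omega>. f (real_vec (q k \<omega>)) * indicator (space M - G) \<omega> \<partial>M)"
      proof -
        have "(\<integral>\<omega>. f (real_vec (q k \<omega>)) \<partial>M) = (\<integral>\<omega>. f (real_vec (q k \<omega>)) * indicator G \<omega> +
            f (real_vec (q k \<omega>)) * indicator (space M - G) \<omega> \<partial>M)"
          by (rule Bochner_Integration.integral_cong) (auto simp: indicator_def)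
        also have "\<dots> = (\<integral>\<omega>. f (real_vec (q k \<omega>)) * indicator G \<omega> \<partial>M) +
            (\<integral>\<omega>. f (real_vec (q k \<omega>)) * indicator (space M - G) \<omega> \<partial>M)"
          by (intro Bochner_Integration.integral_add f_int) measurable
        finally show ?thesis .
      qed
      ultimately show ?thesis unfolding compl by linarith
    qed
    then show "\<exists>N. \<forall>k\<ge>N. (\<integral>\<omega>. f (real_vec (q k \<omega>)) \<partial>M) \<le>
        \<rho> ^ k * exp (\<theta> * real n) + exp_moment_bound + b * prob {\<omega>\<in>space M. real n < W (q 0 \<omega>)}"
      by blast
  qed
  have "(\<lambda>n. exp_moment_bound + b * prob {\<omega>\<in>space M. real n < W (q 0 \<omega>)}) \<longlonglongrightarrow>
      exp_moment_bound + b * 0"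
    by (intro tendsto_intros prob_large_start)
  then have "(\<integral>\<omega>. f (Q \<omega>) \<partial>N) \<le> exp_moment_bound + b * 0"
    by (rule LIMSEQ_le_const) (use le in blast)
  then show ?thesis by (simp add: f_def)
qed

text \<open>The truncated bound is uniform in the level, so monotone convergence removes the
  truncation.\<close>

lemma nn_integral_exp_limit:
  fixes Q :: "'v \<Rightarrow> real ^ 'n"
  assumes N: "prob_space N" and Q[measurable]: "Q \<in> borel_measurable N"
    and conv: "converges_in_distribution M (\<lambda>k \<omega>. real_vec (q k \<omega>)) N Q"
  shows "(\<integral>\<^sup>+\<omega>. ennreal (exp (\<theta> * norm (collapse c (Q \<omega>)))) \<partial>N) \<le> ennreal exp_moment_bound"
proof -
  interpret N: prob_space N by (rule N)
  define g where "g \<omega> = exp (\<theta> * norm (collapse c (Q \<omega>)))" for \<omega>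
  have [measurable]: "g \<in> borel_measurable N" unfolding g_def by measurable
  have g_pos: "0 \<le> g \<omega>" for \<omega> by (simp add: g_def)
  have SUP_min: "(SUP n::nat. ennreal (min (g \<omega>) (real n))) = ennreal (g \<omega>)" for \<omega>
  proof (rule antisym)
    show "(SUP n::nat. ennreal (min (g \<omega>) (real n))) \<le> ennreal (g \<omega>)"
      by (intro SUP_least ennreal_leI) simp
    obtain n where "g \<omega> \<le> real n" using real_arch_simple by blast
    then show "ennreal (g \<omega>) \<le> (SUP n::nat. ennreal (min (g \<omega>) (real n)))"
      by (intro SUP_upper2[of n] ennreal_leI) auto
  qed
  have "(\<integral>\<^sup>+\<omega>. ennreal (g \<omega>) \<partial>N) = (\<integral>\<^sup>+\<omega>. (SUP n::nat. ennreal (min (g \<omega>) (real n))) \<partial>N)"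
    by (simp add: SUP_min)
  also have "\<dots> = (SUP n::nat. \<integral>\<^sup>+\<omega>. ennreal (min (g \<omega>) (real n)) \<partial>N)"
    by (rule nn_integral_monotone_convergence_SUP)
       (auto simp: incseq_def le_fun_def intro!: ennreal_leI min.mono)
  also have "\<dots> \<le> ennreal exp_moment_bound"
  proof (rule SUP_least)
    fix n :: nat
    have "(\<integral>\<^sup>+\<omega>. ennreal (min (g \<omega>) (real n)) \<partial>N) = ennreal (\<integral>\<omega>. min (g \<omega>) (real n) \<partial>N)"
    proof (rule nn_integral_eq_integral)
      show "integrable N (\<lambda>\<omega>. min (g \<omega>) (real n))"
        by (rule N.integrable_const_bound[of _ "real n"]) (auto simp: g_pos)
    qed (simp add: g_pos)
    also have "\<dots> \<le> ennreal exp_moment_bound"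
      unfolding g_def by (intro ennreal_leI limit_truncated_exp conv) simp
    finally show "(\<integral>\<^sup>+\<omega>. ennreal (min (g \<omega>) (real n)) \<partial>N) \<le> ennreal exp_moment_bound" .
  qed
  finally show ?thesis by (simp add: g_def)
qed

text \<open>A power \<open>y ^ m / fact m\<close> with \<open>y \<ge> 0\<close> is a single term of
  the exponential series, so every moment is controlled by the exponential moment.\<close>

lemma perp_moment_bound:
  fixes Q :: "'v \<Rightarrow> real ^ 'n"
  assumes N: "prob_space N" and Q[measurable]: "Q \<in> borel_measurable N"
    and conv: "converges_in_distribution M (\<lambda>k \<omega>. real_vec (q k \<omega>)) N Q"
  shows "integrable N (\<lambda>\<omega>. norm (perp (Q \<omega>)) ^ m)"
    and "(\<integral>\<omega>. norm (perp (Q \<omega>)) ^ m \<partial>N) \<le> fact m / \<theta> ^ m * exp_moment_bound"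
proof -
  have [measurable]: "perp \<in> borel_measurable (borel :: (real ^ 'n) measure)"
    using borel_measurable_collapse[of 1] by (simp add: collapse_1[abs_def])
  have "0 \<le> exp_moment_bound"
    using theta_pos eta_pos by (simp add: exp_moment_bound_def growth_def)
  have pointwise: "norm (perp x) ^ m \<le> fact m / \<theta> ^ m * exp (\<theta> * norm (collapse c x))" for x :: "real ^ 'n"
  proof -
    have "(\<theta> * norm (perp x)) ^ m / fact m \<le> exp (\<theta> * norm (perp x))"
    proof -
      have "(\<lambda>j. (\<theta> * norm (perp x)) ^ j /\<^sub>R fact j) sums exp (\<theta> * norm (perp x))"
        by (rule exp_converges)
      then have "(\<Sum>j\<in>{m}. (\<theta> * norm (perp x)) ^ j /\<^sub>R fact j) \<le> exp (\<theta> * norm (perp x))"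
        unfolding sums_iff using theta_pos by (metis (no_types, lifting) sum_le_suminf finite.intros
          scaleR_nonneg_nonneg zero_le_power mult_nonneg_nonneg norm_ge_zero less_imp_le
          inverse_nonnegative_iff_nonnegative fact_ge_zero)
      then show ?thesis by (simp add: field_simps)
    qed
    also have "\<dots> \<le> exp (\<theta> * norm (collapse c x))"
      using norm_perp_le_collapse[OF c, of x] theta_pos by simp
    finally show ?thesis using theta_pos by (simp add: field_simps power_mult_distrib)
  qed
  have nn: "(\<integral>\<^sup>+\<omega>. ennreal (norm (perp (Q \<omega>)) ^ m) \<partial>N) \<le> ennreal (fact m / \<theta> ^ m * exp_moment_bound)"
  proof -
    have "(\<integral>\<^sup>+\<omega>. ennreal (norm (perp (Q \<omega>)) ^ m) \<partial>N) \<le>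
        (\<integral>\<^sup>+\<omega>. ennreal (fact m / \<theta> ^ m) * ennreal (exp (\<theta> * norm (collapse c (Q \<omega>)))) \<partial>N)"
      using theta_pos pointwise by (intro nn_integral_mono) (simp flip: ennreal_mult)
    also have "\<dots> = ennreal (fact m / \<theta> ^ m) * (\<integral>\<^sup>+\<omega>. ennreal (exp (\<theta> * norm (collapse c (Q \<omega>)))) \<partial>N)"
      by (rule nn_integral_cmult) measurable
    also have "\<dots> \<le> ennreal (fact m / \<theta> ^ m) * ennreal exp_moment_bound"
      by (intro mult_left_mono nn_integral_exp_limit N Q conv) simp
    also have "\<dots> = ennreal (fact m / \<theta> ^ m * exp_moment_bound)"
      using theta_pos \<open>0 \<le> exp_moment_bound\<close> by (intro ennreal_mult[symmetric]) auto
    finally show ?thesis .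
  qed
  show int: "integrable N (\<lambda>\<omega>. norm (perp (Q \<omega>)) ^ m)"
  proof (rule integrableI_bounded)
    show "(\<integral>\<^sup>+\<omega>. ennreal (norm (norm (perp (Q \<omega>)) ^ m)) \<partial>N) < \<infinity>"
      using nn by (simp add: le_less_trans)
  qed measurable
  have "ennreal (\<integral>\<omega>. norm (perp (Q \<omega>)) ^ m \<partial>N) \<le> ennreal (fact m / \<theta> ^ m * exp_moment_bound)"
    using nn int by (subst nn_integral_eq_integral[symmetric]) auto
  then show "(\<integral>\<omega>. norm (perp (Q \<omega>)) ^ m \<partial>N) \<le> fact m / \<theta> ^ m * exp_moment_bound"
    using theta_pos \<open>0 \<le> exp_moment_bound\<close> by (subst (asm) ennreal_le_iff) auto
qed

end

section \<open>Uniform moment bounds\<close>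

theorem proposition3:
  fixes M :: "'w measure" and N :: "real \<Rightarrow> 'v measure"
    and d :: nat and \<mu> :: "real ^ 'n" and \<delta> :: real
    and s :: "nat \<Rightarrow> 'w \<Rightarrow> nat ^ 'n"
    and a :: "real \<Rightarrow> nat \<Rightarrow> 'w \<Rightarrow> nat"
    and D :: "real \<Rightarrow> nat \<Rightarrow> 'w \<Rightarrow> 'n set"
    and r :: "real \<Rightarrow> nat \<Rightarrow> 'w \<Rightarrow> 'n"
    and q :: "real \<Rightarrow> nat \<Rightarrow> 'w \<Rightarrow> nat ^ 'n"
    and qbar :: "real \<Rightarrow> 'v \<Rightarrow> real ^ 'n"
  assumes "2 \<le> d" and "d \<le> CARD('n)"
    and system: "\<And>\<epsilon>. 0 < \<epsilon> \<Longrightarrow> \<epsilon> < entry_sum \<mu> \<Longrightarrow>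
      power_of_d_system M d (a \<epsilon>) s (D \<epsilon>) (r \<epsilon>) (q \<epsilon>)"
    and mean_service: "\<And>i. \<mu> $ i = (\<integral>\<omega>. real (s 1 \<omega> $ i) \<partial>M)"
    and mean_arrivals: "\<And>\<epsilon>. 0 < \<epsilon> \<Longrightarrow> \<epsilon> < entry_sum \<mu> \<Longrightarrow>
      (\<integral>\<omega>. real (a \<epsilon> 1 \<omega>) \<partial>M) = entry_sum \<mu> - \<epsilon>"
    and bounded_service: "\<exists>S_max. \<forall>k i. AE \<omega> in M. s k \<omega> $ i \<le> S_max"
    and bounded_arrivals: "\<exists>A_max. \<forall>\<epsilon> k. 0 < \<epsilon> \<and> \<epsilon> < entry_sum \<mu> \<longrightarrow>
      (AE \<omega> in M. a \<epsilon> k \<omega> \<le> A_max)"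
    and "\<mu> \<in> interior (capacity_region d)"
    and "\<delta> > 0"
    and "\<And>j. d \<le> j \<Longrightarrow> j \<le> CARD('n) - 1 \<Longrightarrow>
      (\<Sum>i=1..j. order_stat \<mu> i) / entry_sum \<mu> - \<delta> \<ge> real (j choose d) / real (CARD('n) choose d)"
  shows "\<exists>C :: nat \<Rightarrow> real. \<forall>\<epsilon>. 0 < \<epsilon> \<and> \<epsilon> < entry_sum \<mu> \<and> \<epsilon> < \<delta> * entry_sum \<mu> \<and>
      prob_space (N \<epsilon>) \<and> qbar \<epsilon> \<in> borel_measurable (N \<epsilon>) \<and>
      converges_in_distribution M (\<lambda>k \<omega>. real_vec (q \<epsilon> k \<omega>)) (N \<epsilon>) (qbar \<epsilon>) \<longrightarrow>
      (\<forall>m\<ge>1. integrable (N \<epsilon>) (\<lambda>\<omega>. norm (perp (qbar \<epsilon> \<omega>)) ^ m) \<and>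
        (\<integral>\<omega>. norm (perp (qbar \<epsilon> \<omega>)) ^ m \<partial>N \<epsilon>) \<le> C m)"
proof -
  define n where "n = real CARD('n)"
  define m where "m = Min (range (\<lambda>i. \<mu> $ i))"
  \<comment> \<open>Half of the smaller of the least service rate and the capacity slack: one
    \<open>e\<close> pays for the averaging term, the other is left as drift.\<close>
  define e where "e = min m (\<delta> * entry_sum \<mu>) / 2"
  obtain S where S: "\<And>k i. AE \<omega> in M. s k \<omega> $ i \<le> S" using bounded_service by blast
  obtain A where A: "\<And>\<epsilon> k. 0 < \<epsilon> \<Longrightarrow> \<epsilon> < entry_sum \<mu> \<Longrightarrow> AE \<omega> in M. a \<epsilon> k \<omega> \<le> A"
    using bounded_arrivals by blast
  have \<mu>_pos: "0 < \<mu> $ i" for i by (rule interior_capacity_region_pos) fact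
  have m: "0 < m" "m \<le> \<mu> $ i" for i using \<mu>_pos by (auto simp: m_def)
  have total: "0 < entry_sum \<mu>" using \<mu>_pos by (simp add: entry_sum_def sum_pos)
  have e: "0 < e" "2 * e \<le> m" "2 * e \<le> \<delta> * entry_sum \<mu>"
    using m(1) total \<open>\<delta> > 0\<close> by (auto simp: e_def)
  have n: "1 \<le> n" by (simp add: n_def Suc_leI)
  \<comment> \<open>Projected indicators have norm at most \<open>n\<close>, so
    \<open>\<eta>\<close> times such a norm is at most \<open>e\<close>.\<close>
  define \<eta> where "\<eta> = e / n"
  define L where "L = real CARD('n) * (real A + real S) + \<eta>"
  define K where "K = 2 * real CARD('n) * (real S)\<^sup>2 + L\<^sup>2"
  define \<theta> where "\<theta> = \<eta> / (4 * L\<^sup>2)"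
  have \<eta>: "0 < \<eta>" using e n by (simp add: \<eta>_def)
  show ?thesis
  \<comment> \<open>The witness is the bound of \<open>perp_moment_bound\<close> with its constants
    written out; all of them were fixed before \<epsilon>, which makes it uniform.\<close>
  proof (intro exI[of _ "\<lambda>k. fact k / \<theta> ^ k * (2 * exp (\<theta> * (2 * K / \<eta> + L)) / (\<theta> * \<eta>))"] allI impI)
    fix \<epsilon> k assume *: "0 < \<epsilon> \<and> \<epsilon> < entry_sum \<mu> \<and> \<epsilon> < \<delta> * entry_sum \<mu> \<and>
      prob_space (N \<epsilon>) \<and> qbar \<epsilon> \<in> borel_measurable (N \<epsilon>) \<and>
      converges_in_distribution M (\<lambda>k \<omega>. real_vec (q \<epsilon> k \<omega>)) (N \<epsilon>) (qbar \<epsilon>)"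
    then have \<epsilon>: "0 < \<epsilon>" "\<epsilon> < entry_sum \<mu>" by auto
    \<comment> \<open>For \<epsilon> at least \<open>e\<close>, the identity works because the total
      service rate exceeds the arrival rate by at least \<open>e\<close>. For smaller \<epsilon> the
      total is projected out, at a cost of at most \<open>e\<close>.\<close>
    define c :: real where "c = (if e \<le> \<epsilon> then 0 else 1)"
    have c: "c \<in> {0, 1}" and c\<epsilon>: "0 \<le> c" "c * \<epsilon> \<le> e" using e by (auto simp: c_def)
    interpret sys: power_of_d_system M d "a \<epsilon>" s "D \<epsilon>" "r \<epsilon>" "q \<epsilon>"
      by (rule system[OF \<epsilon>])
    \<comment> \<open>The trailing \<open>- \<epsilon>\<close> is the arrival rate minus the total
      service rate.\<close>
    have drift: "(real (card U choose d) / real (CARD('n) choose d)) * (entry_sum \<mu> - \<epsilon>) -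
        (\<Sum>i\<in>U. \<mu> $ i) - c * real (card U) / real CARD('n) * - \<epsilon>
        \<le> - \<eta> * norm (collapse c (ind_vec U))" for U :: "'n set"
    proof -
      define \<beta> where "\<beta> = real (card U choose d) / real (CARD('n) choose d)"
      have "\<eta> * norm (collapse c (ind_vec U)) \<le> \<eta> * n"
        using norm_collapse_ind_vec_le[OF c, of U] \<eta> unfolding n_def by (intro mult_left_mono) auto
      then have rhs: "- e \<le> - \<eta> * norm (collapse c (ind_vec U))"
        using n by (simp add: \<eta>_def)
      have card_le: "card U \<le> CARD('n)" by (rule card_mono) auto
      have "c * real (card U) / real CARD('n) * \<epsilon> = c * \<epsilon> * (real (card U) / real CARD('n))"
        by simp
      also have "\<dots> \<le> c * \<epsilon> * 1"
        using c\<epsilon> \<epsilon>(1) card_le by (intro mult_left_mono) auto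
      finally have fluct: "c * real (card U) / real CARD('n) * \<epsilon> \<le> e" using c\<epsilon> by simp
      consider "U = {}" | "U = UNIV" | "U \<noteq> {}" "card U < d" | "U \<noteq> UNIV" "d \<le> card U" by linarith
      then show ?thesis
      proof cases
        case 1
        then show ?thesis using \<open>2 \<le> d\<close> by (simp add: collapse_ind_vec_empty binomial_eq_0)
      next
        case 2
        have "real (CARD('n) choose d) \<noteq> 0" using \<open>d \<le> CARD('n)\<close> by simp
        then have lhs: "(real (card U choose d) / real (CARD('n) choose d)) * (entry_sum \<mu> - \<epsilon>) -
            (\<Sum>i\<in>U. \<mu> $ i) - c * real (card U) / real CARD('n) * - \<epsilon> = c * \<epsilon> - \<epsilon>"
          using 2 by (simp add: entry_sum_def)
        \<comment> \<open>With \<open>c = 0\<close> the left side is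
          \<open>- \<epsilon> \<le> - e\<close>; with \<open>c = 1\<close> both sides vanish, since
          \<open>perp\<close> kills constant vectors.\<close>
        show ?thesis
        proof (cases "e \<le> \<epsilon>")
          case True
          then show ?thesis unfolding lhs using rhs by (simp add: c_def)
        next
          case False
          then show ?thesis unfolding lhs using 2 by (simp add: c_def collapse_1 perp_ind_vec_UNIV)
        qed
      next
        case 3
        \<comment> \<open>No \<open>d\<close> distinct servers fit into \<open>U\<close>, so it
          receives no arrivals, while its service rate is at least \<open>m\<close>.\<close>
        then have "1 \<le> card U" by (simp add: Suc_le_eq card_gt_0_iff)
        then have "m \<le> real (card U) * m" using m(1) by simp
        also have "\<dots> \<le> (\<Sum>i\<in>U. \<mu> $ i)" using m(2) by (simp add: sum_bounded_below)
        finally show ?thesis using 3 fluct rhs e by (simp add: binomial_eq_0)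
      next
        case 4
        \<comment> \<open>The size of \<open>U\<close> lies in the range of the slack hypothesis,
          which then leaves a surplus of service of at least
          \<open>\<delta> * entry_sum \<mu>\<close>.\<close>
        then have "card U < CARD('n)" by (simp add: psubset_card_mono psubsetI)
        then have "\<beta> \<le> (\<Sum>i=1..card U. order_stat \<mu> i) / entry_sum \<mu> - \<delta>"
          using 4 assms(10)[of "card U"] unfolding \<beta>_def by simp
        also have "\<dots> \<le> (\<Sum>i\<in>U. \<mu> $ i) / entry_sum \<mu> - \<delta>"
          using sum_order_stat_le[of \<mu> U] total by (simp add: divide_right_mono)
        finally have "\<beta> * entry_sum \<mu> \<le> (\<Sum>i\<in>U. \<mu> $ i) - \<delta> * entry_sum \<mu>"
          using total by (simp add: field_simps)
        moreover have "0 \<le> \<beta> * \<epsilon>" using \<epsilon> by (simp add: \<beta>_def)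
        ultimately show ?thesis
          using fluct rhs e unfolding \<beta>_def[symmetric] by (simp add: right_diff_distrib)
      qed
    qed
    interpret drift_system M d "a \<epsilon>" s "D \<epsilon>" "r \<epsilon>" "q \<epsilon>" A S c \<eta> \<mu> L K \<theta>
      by unfold_locales
        (use drift mean_arrivals[OF \<epsilon>] in \<open>simp_all add: A[OF \<epsilon>] S mean_service[symmetric, unfolded One_nat_def] c[simplified] \<eta> L_def
          K_def \<theta>_def entry_sum_def\<close>)
    show "integrable (N \<epsilon>) (\<lambda>\<omega>. norm (perp (qbar \<epsilon> \<omega>)) ^ k) \<and>
        (\<integral>\<omega>. norm (perp (qbar \<epsilon> \<omega>)) ^ k \<partial>N \<epsilon>) \<le>
        fact k / \<theta> ^ k * (2 * exp (\<theta> * (2 * K / \<eta> + L)) / (\<theta> * \<eta>))"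
      using perp_moment_bound[of "N \<epsilon>" "qbar \<epsilon>" k] * by (simp add: exp_moment_bound_def growth_def)
  qed
qed

end
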